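(* Let $(S,\mathbf{P}_N)$, $(\omega,\mathbb{P})$ and $\{H_{N,\omega}\}_N$ be as in the interface set-up described in the context; in particular the Basic Hypothesis holds and the free energy $f$ exists. Let $Z_{N,\omega}=\mathbf{E}[\exp(H_{N,\omega}(S))]$ and let $$\tilde f:=\liminf_{N\to\infty}\frac1{N^d}\log\mathbb{E}\big[Z_{N,\omega}\big]\in[0,\infty]$$ be the annealed free energy. If $\tilde f>0$, then for every local bounded measurable function $F:\Gamma^{\mathbb{Z}^d}\to\mathbb{R}$ such that $\mathbb{E}[F(\omega)]=0$ one has $$\liminf_{N\to\infty}\frac1{N^d}\log\mathbb{E}\,\mathbf{E}\left[\exp\left(H_{N,\omega}(S)+\sum_{n\in V_N}F(\theta_n\omega)\right)\right]>0,$$ where $(\theta_n\omega)_m=\omega_{n+m}$ for $n,m\in\mathbb{Z}^d$.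
   Context: Let $d>1$ be an integer and $V_N=[-N/2,N/2]^d\cap\mathbb{Z}^d$. Interface: $S=\{S_n\}_{n\in\mathbb{Z}^d}$ is a random field with $S_n\in\mathbb{R}$, whose law $\mathbf{P}=\mathbf{P}_N$ (expectation $\mathbf{E}=\mathbf{E}_N$) depends on $N$ and is the probability measure $$\mathbf{P}_N(\mathrm{d}\varphi)\propto\exp\left(-\frac12\sum_{n,n':\,|n-n'|=1}U(\varphi_n-\varphi_{n'})\right)\prod_{n\in V_N}\mathrm{d}\varphi_n\prod_{n\in V_N^{\complement}}\delta_0(\mathrm{d}\varphi_n),$$ where the sum is over ordered nearest-neighbour pairs $(n,n')$ in $\mathbb{Z}^d$ with at least one element in $V_N$ (the other pairs only contribute a constant), and $U:\mathbb{R}\to\mathbb{R}$ is an even measurable function with $\lim_{r\to\pm\infty}U(r)=+\infty$ sufficiently rapidly that the right-hand side is integrable. Disorder: $\omega=\{\omega_n\}_{n\in\mathbb{Z}^d}$ is a field of IID random variables with law $\mathbb{P}$ and expectation $\mathbb{E}$, taking values in $\Gamma\subseteq\mathbb{R}$. Under $\mathbb{E}\,\mathbf{E}$, $\omega$ and $S$ are independent with laws $\mathbb{P}$ and $\mathbf{P}_N$. Hamiltonian: for each $N$, $H_{N,\omega}(S)$ is a function of $\omega$ and $S$, depending on $S$ only through $\{S_n\}_{n\in V_N}$, and measurable in $(\omega,S)$. The value $-\infty$ is allowed (with $e^{-\infty}=0$). The partition function is $Z_{N,\omega}:=\mathbf{E}[\exp(H_{N,\omega}(S))]$. Basic Hypothesis: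 there exists a family $\{D_n\}_{n\in\mathbb{Z}^d}$ of measurable subsets of $\mathbb{R}$ such that $$\lim_{N\to\infty}\frac1{N^d}\log\mathbf{P}_N\left(S_n\in D_n\text{ for }n\in V_N\right)=0,$$ and such that $H_{N,\omega}(S)=0$ whenever $S_n\in D_n$ for every $n\in V_N$. Existence of the free energy: $\{N^{-d}\log Z_{N,\omega}\}_N$ is a sequence of integrable random variables that converges in $L^1(\mathbb{P})$ and $\mathbb{P}$-almost surely to a constant $f$, called the quenched free energy. A function $F:\Gamma^{\mathbb{Z}^d}\to\mathbb{R}$ is local if it depends only on finitely many coordinates of $\omega$. *)

theory Defs
  imports "HOL-Probability.Probability"
begin

text \<open>Sites are elements of \<^typ>\<open>int ^ 'd\<close>, so the dimension is \<^term>\<open>CARD('d)\<close>.\<close>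

type_synonym 'd config = "int ^ 'd \<Rightarrow> real"

subsection \<open>Exponential and logarithm with infinite values\<close>

definition exp_ext :: "ereal \<Rightarrow> ennreal" where
  "exp_ext x = (case x of ereal r \<Rightarrow> ennreal (exp r) | PInfty \<Rightarrow> \<infinity> | MInfty \<Rightarrow> 0)"

text \<open>The library's real logarithm has \<open>ln 0 = 0\<close>; here the logarithm of 0 is \<open>-\<infinity>\<close>.\<close>

definition ln_ext :: "ennreal \<Rightarrow> ereal" where
  "ln_ext x = (if x = 0 then -\<infinity> else if x = \<infinity> then \<infinity> else ereal (ln (enn2real x)))"

subsection \<open>The box and the interface\<close>

definition box_V :: "nat \<Rightarrow> (int ^ 'd) set" where
  "box_V N = {n. \<forall>i. - (real N / 2) \<le> real_of_int (n $ i) \<and> real_of_int (n $ i) \<le> real N / 2}"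

text \<open>Nearest neighbours are at Euclidean distance 1, measured after embedding the lattice into
  \<^typ>\<open>real ^ 'd\<close>.  The pairs are ordered.\<close>

definition nn_pairs :: "nat \<Rightarrow> ((int ^ 'd) \<times> (int ^ 'd)) set" where
  "nn_pairs N = {(n, n'). norm ((\<chi> i. real_of_int (n $ i - n' $ i)) :: real ^ 'd) = 1 \<and>
      (n \<in> box_V N \<or> n' \<in> box_V N)}"

definition config_space :: "('d::finite config) measure" where
  "config_space = PiM UNIV (\<lambda>_. borel)"

text \<open>Lebesgue measure at the sites of the box and the Dirac mass at 0 at all other sites.\<close>

definition ref_measure :: "nat \<Rightarrow> ('d::finite config) measure" where
  "ref_measure N = distr (PiM (box_V N) (\<lambda>_. lborel)) config_space
     (\<lambda>\<phi> n. if n \<in> box_V N then \<phi> n else 0)"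

definition gibbs_weight :: "(real \<Rightarrow> real) \<Rightarrow> nat \<Rightarrow> 'd::finite config \<Rightarrow> real" where
  "gibbs_weight U N \<phi> = exp (- (1/2) * (\<Sum>(n, n') \<in> nn_pairs N. U (\<phi> n - \<phi> n')))"

definition interface_law :: "(real \<Rightarrow> real) \<Rightarrow> nat \<Rightarrow> ('d::finite config) measure" where
  "interface_law U N = density (ref_measure N)
     (\<lambda>\<phi>. ennreal (gibbs_weight U N \<phi>) / (\<integral>\<^sup>+(\<psi> :: 'd config). ennreal (gibbs_weight U N \<psi>) \<partial>ref_measure N))"

subsection \<open>The disorder\<close>

text \<open>The disorder is realised as the coordinate process on \<open>\<Gamma>\<close>-valued configurations, so that
  \<open>P\<close> is the law of the whole field.\<close>

definition iid_field_law :: "real set \<Rightarrow> ('d::finite config) measure \<Rightarrow> bool" where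
  "iid_field_law \<Gamma> P \<longleftrightarrow>
     prob_space P \<and>
     sets P = sets (PiM UNIV (\<lambda>_. restrict_space borel \<Gamma>)) \<and>
     prob_space.indep_vars P (\<lambda>_. restrict_space borel \<Gamma>) (\<lambda>n \<omega>. \<omega> n) UNIV \<and>
     (\<forall>n m. distr P (restrict_space borel \<Gamma>) (\<lambda>\<omega>. \<omega> n) = distr P (restrict_space borel \<Gamma>) (\<lambda>\<omega>. \<omega> m))"

definition theta :: "int ^ 'd \<Rightarrow> 'd config \<Rightarrow> 'd config" where
  "theta n \<omega> = (\<lambda>m. \<omega> (n + m))"

definition local_function :: "real set \<Rightarrow> ('d::finite config \<Rightarrow> real) \<Rightarrow> bool" where
  "local_function \<Gamma> F \<longleftrightarrow> (\<exists>A. finite A \<and>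
     (\<forall>\<omega> \<in> UNIV \<rightarrow>\<^sub>E \<Gamma>. \<forall>\<omega>' \<in> UNIV \<rightarrow>\<^sub>E \<Gamma>. (\<forall>n \<in> A. \<omega> n = \<omega>' n) \<longrightarrow> F \<omega> = F \<omega>'))"

subsection \<open>Hamiltonian, partition function and free energy\<close>

definition hamiltonian ::
  "('d::finite config) measure \<Rightarrow> (nat \<Rightarrow> 'd config \<Rightarrow> 'd config \<Rightarrow> ereal) \<Rightarrow> bool" where
  "hamiltonian P H \<longleftrightarrow> (\<forall>N>0.
     (\<forall>\<omega> \<in> space P. \<forall>s. H N \<omega> s < \<infinity>) \<and>
     (\<forall>\<omega> \<in> space P. \<forall>s s'. (\<forall>n \<in> box_V N. s n = s' n) \<longrightarrow> H N \<omega> s = H N \<omega> s') \<and>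
     (\<lambda>(\<omega>, s). H N \<omega> s) \<in> borel_measurable (P \<Otimes>\<^sub>M config_space))"

definition partition_function ::
  "(real \<Rightarrow> real) \<Rightarrow> (nat \<Rightarrow> 'd::finite config \<Rightarrow> 'd config \<Rightarrow> ereal) \<Rightarrow> nat \<Rightarrow> 'd config \<Rightarrow> ennreal" where
  "partition_function U H N \<omega> = (\<integral>\<^sup>+s. exp_ext (H N \<omega> s) \<partial>interface_law U N)"

definition basic_hypothesis ::
  "(real \<Rightarrow> real) \<Rightarrow> ('d::finite config) measure \<Rightarrow> (nat \<Rightarrow> 'd config \<Rightarrow> 'd config \<Rightarrow> ereal) \<Rightarrow> bool" where
  "basic_hypothesis U P H \<longleftrightarrow> (\<exists>D :: int ^ 'd \<Rightarrow> real set.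
     (\<forall>n. D n \<in> sets borel) \<and>
     (\<lambda>N. ln_ext (emeasure (interface_law U N)
            {s \<in> space (interface_law U N). \<forall>n \<in> box_V N. s n \<in> D n})
          / ereal (real N ^ CARD('d))) \<longlonglongrightarrow> 0 \<and>
     (\<forall>N>0. \<forall>\<omega> \<in> space P. \<forall>s. (\<forall>n \<in> box_V N. s n \<in> D n) \<longrightarrow> H N \<omega> s = 0))"

text \<open>The partition function is almost surely in \<open>(0, \<infinity>)\<close>, so that its normalised logarithm is a
  real random variable up to a null set.\<close>

definition quenched_free_energy ::
  "(real \<Rightarrow> real) \<Rightarrow> ('d::finite config) measure \<Rightarrow> (nat \<Rightarrow> 'd config \<Rightarrow> 'd config \<Rightarrow> ereal) \<Rightarrow> real \<Rightarrow> bool" where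
  "quenched_free_energy U P H f \<longleftrightarrow>
     (let X = (\<lambda>N \<omega>. real_of_ereal (ln_ext (partition_function U H N \<omega>)) / real N ^ CARD('d)) in
       (\<forall>N>0. (AE \<omega> in P. \<bar>ln_ext (partition_function U H N \<omega>)\<bar> \<noteq> \<infinity>) \<and> integrable P (X N)) \<and>
       (\<lambda>N. \<integral>\<omega>. \<bar>X N \<omega> - f\<bar> \<partial>P) \<longlonglongrightarrow> 0 \<and>
       (AE \<omega> in P. (\<lambda>N. X N \<omega>) \<longlonglongrightarrow> f))"

definition annealed_free_energy ::
  "(real \<Rightarrow> real) \<Rightarrow> ('d::finite config) measure \<Rightarrow> (nat \<Rightarrow> 'd config \<Rightarrow> 'd config \<Rightarrow> ereal) \<Rightarrow> ereal" where
  "annealed_free_energy U P H =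
     liminf (\<lambda>N. ln_ext (\<integral>\<^sup>+\<omega>. partition_function U H N \<omega> \<partial>P) / ereal (real N ^ CARD('d)))"

end

theory Submission
  imports Defs
begin

text \<open>Write \<open>G\<^sub>N(\<omega>)\<close> for the sum of \<open>F(\<theta>\<^sub>n \<omega>)\<close> over the box \<open>V\<^sub>N\<close>.  The proof rests on a
  dichotomy for the centred local function \<open>F\<close>: either the exponential moment of \<open>G\<^sub>N\<close> grows
  exponentially in the volume, or \<open>G\<^sub>N\<close> is almost surely bounded below by a negative multiple of
  the size of a boundary layer.  The criterion is whether some bounded observable \<open>h\<close>, depending on
  finitely many sites, has a nonzero correlation \<open>\<Sum>n. E[h F(\<theta>\<^sub>n \<omega>)]\<close> with the total field.  The sum
  is finite, because distant terms are independent of \<open>h\<close> and have mean zero.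

  If such an \<open>h\<close> exists, it may be taken centred and small.  Multiply the law of the disorder by
  the factors \<open>1 + h(\<theta>\<^sub>x \<omega>)\<close>, with \<open>x\<close> on a grid so coarse that no term of \<open>G\<^sub>N\<close> sees two of them.
  Each factor raises the mean of \<open>G\<^sub>N\<close> by the correlation, linear in \<open>h\<close>, and costs an entropy of at
  most \<open>E[h\<^sup>2]\<close>, quadratic in \<open>h\<close>.  The entropy inequality then gives exponential growth
  (lemmas \<open>expectation_exp_sum_ge\<close> and \<open>exponential_growth\<close>).  On the event \<open>S \<in> D\<close> the Hamiltonian
  vanishes, and by independence the expectation in question is at least the product of the
  probability of this event, which is not exponentially small in the volume, and the exponential
  moment of \<open>G\<^sub>N\<close>.

  If all correlations vanish, take for \<open>h\<close> the indicator of an event in which \<open>G\<^sub>N\<close> is very negative.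
  The correlation of \<open>G\<^sub>N\<close> with \<open>h\<close> is then minus that of the terms in a boundary layer outside the
  box, hence is at least minus the size of the layer, up to a constant, times the probability of
  the event.  Below this level the event is therefore null (lemma \<open>boundary_lower_bound\<close>).  So
  \<open>G\<^sub>N\<close> lowers the expectation at most by a factor that is subexponential in the volume, and the
  positivity of the annealed free energy carries over.\<close>

section \<open>Observables of an i.i.d. field\<close>

locale iid_field =
  fixes \<Gamma> :: "real set" and P :: "('d::finite config) measure"
  assumes iid: "iid_field_law \<Gamma> P"
begin

sublocale prob_space P
  using iid by (simp add: iid_field_law_def)

lemma sets_P: "sets P = sets (PiM UNIV (\<lambda>_. restrict_space borel \<Gamma>))"
  using iid by (simp add: iid_field_law_def)

lemma space_P: "space P = (UNIV \<rightarrow>\<^sub>E \<Gamma>)"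
  using sets_eq_imp_space_eq[OF sets_P] by (simp add: space_PiM space_restrict_space)

lemma mem_space_P: "\<omega> \<in> space P \<longleftrightarrow> (\<forall>n. \<omega> n \<in> \<Gamma>)"
  by (auto simp: space_P PiE_UNIV_domain)

lemma indep_coordinates: "indep_vars (\<lambda>_. restrict_space borel \<Gamma>) (\<lambda>n \<omega>. \<omega> n) UNIV"
  using iid by (simp add: iid_field_law_def)

lemma theta_space: "\<omega> \<in> space P \<Longrightarrow> theta n \<omega> \<in> space P"
  by (simp add: mem_space_P theta_def)

lemma measurable_theta: "theta n \<in> measurable P P"
proof -
  have "(\<lambda>\<omega> m. \<omega> (n + m)) \<in>
      measurable (PiM UNIV (\<lambda>_. restrict_space borel \<Gamma>)) (PiM UNIV (\<lambda>_. restrict_space borel \<Gamma>))"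
    by (intro measurable_PiM_single') (auto simp: space_PiM)
  then show ?thesis
    by (subst measurable_cong_sets[OF sets_P sets_P]) (simp add: theta_def[abs_def])
qed

text \<open>The law is a product of identical factors, and a shift merely relabels them.\<close>

lemma distr_theta: "distr P P (theta n) = P"
proof -
  define B where "B = (restrict_space borel \<Gamma> :: real measure)"
  define \<nu> where "\<nu> = distr P B (\<lambda>\<omega>. \<omega> 0)"
  have meas: "(\<lambda>\<omega>. \<omega> m) \<in> measurable P B" for m
    unfolding measurable_cong_sets[OF sets_P refl] B_def by simp
  have same: "distr P B (\<lambda>\<omega>. \<omega> m) = \<nu>" for m
    using iid unfolding iid_field_law_def B_def \<nu>_def by blast
  have "prob_space \<nu>" unfolding \<nu>_def by (rule prob_space_distr[OF meas])
  have "P = distr P (PiM UNIV (\<lambda>_. B)) (\<lambda>\<omega>. \<lambda>m\<in>UNIV. \<omega> m)"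
    unfolding B_def restrict_UNIV by (rule distr_id2[OF sets_P[symmetric], symmetric])
  also have "\<dots> = PiM UNIV (\<lambda>m. distr P B (\<lambda>\<omega>. \<omega> m))"
    using indep_coordinates meas
    by (subst indep_vars_iff_distr_eq_PiM[symmetric]) (auto simp: B_def)
  also have "\<dots> = PiM UNIV (\<lambda>_. \<nu>)" unfolding same ..
  finally have P: "P = PiM UNIV (\<lambda>_. \<nu>)" .
  have "distr (PiM UNIV (\<lambda>_. \<nu>)) (PiM UNIV (\<lambda>_. \<nu>)) (\<lambda>\<omega>. \<lambda>m\<in>UNIV. \<omega> (n + m)) = PiM UNIV (\<lambda>_. \<nu>)"
    by (rule distr_PiM_reindex) (auto simp: \<open>prob_space \<nu>\<close>)
  then show ?thesis unfolding P[symmetric] theta_def[abs_def] restrict_UNIV .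
qed

text \<open>Dependence on the sites in \<open>A\<close> is expressed pointwise, so that it is monotone in \<open>A\<close> and
  independent of the choice of a measurable factorisation through the restriction to \<open>A\<close>.\<close>

definition observable :: "(int ^ 'd) set \<Rightarrow> ('d config \<Rightarrow> real) \<Rightarrow> bool" where
  "observable A f \<longleftrightarrow> f \<in> borel_measurable P \<and> (\<exists>K. \<forall>\<omega> \<in> space P. \<bar>f \<omega>\<bar> \<le> K) \<and>
     (\<forall>\<omega> \<in> space P. \<forall>\<omega>' \<in> space P. (\<forall>n \<in> A. \<omega> n = \<omega>' n) \<longrightarrow> f \<omega> = f \<omega>')"

lemma observableI:
  assumes "f \<in> borel_measurable P" "\<And>\<omega>. \<omega> \<in> space P \<Longrightarrow> \<bar>f \<omega>\<bar> \<le> K"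
    and "\<And>\<omega> \<omega>'. \<omega> \<in> space P \<Longrightarrow> \<omega>' \<in> space P \<Longrightarrow> (\<And>n. n \<in> A \<Longrightarrow> \<omega> n = \<omega>' n) \<Longrightarrow> f \<omega> = f \<omega>'"
  shows "observable A f"
  unfolding observable_def
proof (intro conjI ballI impI exI)
  fix \<omega> \<omega>' assume "\<omega> \<in> space P" "\<omega>' \<in> space P" "\<forall>n\<in>A. \<omega> n = \<omega>' n"
  then show "f \<omega> = f \<omega>'" by (intro assms(3)) auto
qed (use assms(1,2) in auto)

lemma observableD:
  assumes "observable A f" "\<omega> \<in> space P" "\<omega>' \<in> space P" "\<And>n. n \<in> A \<Longrightarrow> \<omega> n = \<omega>' n"
  shows "f \<omega> = f \<omega>'"
  using assms unfolding observable_def by blast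

lemma observable_measurable: "observable A f \<Longrightarrow> f \<in> borel_measurable P"
  by (simp add: observable_def)

lemma observable_const: "observable A (\<lambda>_. c)"
  by (auto simp: observable_def)

text \<open>Only the values that are actually attained have to be controlled.  This covers the logarithm of
  an observable that is bounded away from 0.\<close>

lemma observable_compose2:
  fixes \<phi> :: "real \<Rightarrow> real \<Rightarrow> real"
  assumes "observable A f" "observable A g"
    and "(\<lambda>\<omega>. \<phi> (f \<omega>) (g \<omega>)) \<in> borel_measurable P"
    and "\<And>\<omega>. \<omega> \<in> space P \<Longrightarrow> \<bar>\<phi> (f \<omega>) (g \<omega>)\<bar> \<le> K"
  shows "observable A (\<lambda>\<omega>. \<phi> (f \<omega>) (g \<omega>))"
proof (rule observableI)
  fix \<omega> \<omega>' assume *: "\<omega> \<in> space P" "\<omega>' \<in> space P" "\<And>n. n \<in> A \<Longrightarrow> \<omega> n = \<omega>' n"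
  show "\<phi> (f \<omega>) (g \<omega>) = \<phi> (f \<omega>') (g \<omega>')"
    using observableD[OF assms(1) *] observableD[OF assms(2) *] by simp
qed (fact assms)+

lemma observable_compose:
  fixes \<phi> :: "real \<Rightarrow> real"
  assumes "observable A f" "(\<lambda>\<omega>. \<phi> (f \<omega>)) \<in> borel_measurable P"
    and "\<And>\<omega>. \<omega> \<in> space P \<Longrightarrow> \<bar>\<phi> (f \<omega>)\<bar> \<le> K"
  shows "observable A (\<lambda>\<omega>. \<phi> (f \<omega>))"
  by (rule observable_compose2[of A f f "\<lambda>x _. \<phi> x" K, OF assms(1) assms])

lemma observable_bound:
  assumes "observable A f" obtains K where "K \<ge> 0" "\<And>\<omega>. \<omega> \<in> space P \<Longrightarrow> \<bar>f \<omega>\<bar> \<le> K"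
proof -
  obtain K where K: "\<forall>\<omega> \<in> space P. \<bar>f \<omega>\<bar> \<le> K"
    using assms unfolding observable_def by blast
  show ?thesis
  proof (rule that[of "\<bar>K\<bar>"])
    show "\<bar>f \<omega>\<bar> \<le> \<bar>K\<bar>" if "\<omega> \<in> space P" for \<omega>
      by (rule order_trans[OF K[rule_format, OF that] abs_ge_self])
  qed simp
qed

lemma observable_integrable:
  assumes "observable A f" shows "integrable P f"
proof -
  obtain K where "K \<ge> 0" and K: "\<And>\<omega>. \<omega> \<in> space P \<Longrightarrow> \<bar>f \<omega>\<bar> \<le> K"
    by (rule observable_bound[OF assms]) blast
  show ?thesis
    by (rule integrable_const_bound[of _ K]) (simp_all add: K observable_measurable[OF assms])
qed

lemma observable_mono:
  assumes "observable A f" "A \<subseteq> B" shows "observable B f"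
proof -
  obtain K where "K \<ge> 0" and K: "\<And>\<omega>. \<omega> \<in> space P \<Longrightarrow> \<bar>f \<omega>\<bar> \<le> K"
    by (rule observable_bound[OF assms(1)]) blast
  show ?thesis
  proof (rule observableI[OF observable_measurable[OF assms(1)] K])
    fix \<omega> \<omega>' assume "\<omega> \<in> space P" "\<omega>' \<in> space P" "\<And>n. n \<in> B \<Longrightarrow> \<omega> n = \<omega>' n"
    then show "f \<omega> = f \<omega>'" using assms(2) by (intro observableD[OF assms(1)]) auto
  qed
qed

lemma observable_add:
  assumes "observable A f" "observable A g" shows "observable A (\<lambda>\<omega>. f \<omega> + g \<omega>)"
proof -
  obtain K where "K \<ge> 0" and K: "\<And>\<omega>. \<omega> \<in> space P \<Longrightarrow> \<bar>f \<omega>\<bar> \<le> K"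
    by (rule observable_bound[OF assms(1)]) blast
  obtain L where "L \<ge> 0" and L: "\<And>\<omega>. \<omega> \<in> space P \<Longrightarrow> \<bar>g \<omega>\<bar> \<le> L"
    by (rule observable_bound[OF assms(2)]) blast
  have "\<bar>f \<omega> + g \<omega>\<bar> \<le> K + L" if "\<omega> \<in> space P" for \<omega>
    using K[OF that] L[OF that] by linarith
  then show ?thesis
    using assms[THEN observable_measurable] by (intro observable_compose2[OF assms]) auto
qed

lemma observable_mult:
  assumes "observable A f" "observable A g" shows "observable A (\<lambda>\<omega>. f \<omega> * g \<omega>)"
proof -
  obtain K where K: "K \<ge> 0" "\<And>\<omega>. \<omega> \<in> space P \<Longrightarrow> \<bar>f \<omega>\<bar> \<le> K"
    by (rule observable_bound[OF assms(1)]) blast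
  obtain L where L: "L \<ge> 0" "\<And>\<omega>. \<omega> \<in> space P \<Longrightarrow> \<bar>g \<omega>\<bar> \<le> L"
    by (rule observable_bound[OF assms(2)]) blast
  have "\<bar>f \<omega> * g \<omega>\<bar> \<le> K * L" if "\<omega> \<in> space P" for \<omega>
    using K(2)[OF that] L(2)[OF that] K(1) by (simp add: abs_mult mult_mono)
  then show ?thesis
    using assms[THEN observable_measurable] by (intro observable_compose2[OF assms]) auto
qed

lemma observable_sum: "(\<And>j. j \<in> J \<Longrightarrow> observable A (f j)) \<Longrightarrow> observable A (\<lambda>\<omega>. \<Sum>j\<in>J. f j \<omega>)"
  by (induction J rule: infinite_finite_induct) (simp_all add: observable_add observable_const)

lemma observable_prod: "(\<And>j. j \<in> J \<Longrightarrow> observable A (f j)) \<Longrightarrow> observable A (\<lambda>\<omega>. \<Prod>j\<in>J. f j \<omega>)"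
  by (induction J rule: infinite_finite_induct) (simp_all add: observable_mult observable_const)

lemma observable_theta:
  assumes "observable A f" shows "observable ((+) n ` A) (\<lambda>\<omega>. f (theta n \<omega>))"
proof -
  obtain K where "K \<ge> 0" and K: "\<And>\<omega>. \<omega> \<in> space P \<Longrightarrow> \<bar>f \<omega>\<bar> \<le> K"
    by (rule observable_bound[OF assms]) blast
  show ?thesis
  proof (rule observableI)
    show "(\<lambda>\<omega>. f (theta n \<omega>)) \<in> borel_measurable P"
      by (rule measurable_compose[OF measurable_theta observable_measurable[OF assms]])
    fix \<omega> assume \<omega>: "\<omega> \<in> space P"
    then show "\<bar>f (theta n \<omega>)\<bar> \<le> K" by (intro K theta_space)
    fix \<omega>' assume "\<omega>' \<in> space P" "\<And>m. m \<in> (+) n ` A \<Longrightarrow> \<omega> m = \<omega>' m"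
    with \<omega> show "f (theta n \<omega>) = f (theta n \<omega>')"
      by (intro observableD[OF assms] theta_space) (auto simp: theta_def)
  qed
qed

lemma expectation_theta:
  fixes f :: "'d config \<Rightarrow> real"
  assumes "f \<in> borel_measurable P" shows "expectation (\<lambda>\<omega>. f (theta n \<omega>)) = expectation f"
  using integral_distr[OF measurable_theta assms, of n] by (simp add: distr_theta)

text \<open>Freezing the coordinates outside \<open>A\<close> turns an observable into a measurable function of the
  restriction to \<open>A\<close>, so independence of the coordinates applies to disjoint sets.\<close>

lemma expectation_mult_disjoint:
  assumes f: "observable A f" and g: "observable B g" and "A \<inter> B = {}"
  shows "expectation (\<lambda>\<omega>. f \<omega> * g \<omega>) = expectation f * expectation g"
proof -
  let ?B = "restrict_space borel \<Gamma> :: real measure"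
  obtain \<omega>0 where \<omega>0: "\<omega>0 \<in> space P" using not_empty by blast
  define ext where "ext C \<eta> = (\<lambda>n. if n \<in> C then \<eta> n else \<omega>0 n)" for C and \<eta> :: "'d config"
  have \<omega>0_mem: "\<omega>0 n \<in> \<Gamma>" for n using \<omega>0 by (simp add: mem_space_P)
  have ext: "ext C \<in> measurable (PiM C (\<lambda>_. ?B)) P" for C
  proof -
    have "ext C \<in> measurable (PiM C (\<lambda>_. ?B)) (PiM UNIV (\<lambda>_. ?B))"
    proof (rule measurable_PiM_single')
      show "(\<lambda>\<eta>. ext C \<eta> n) \<in> measurable (PiM C (\<lambda>_. ?B)) ?B" for n
        using \<omega>0_mem by (cases "n \<in> C") (auto simp: ext_def space_restrict_space)
      show "ext C \<in> space (PiM C (\<lambda>_. ?B)) \<rightarrow> UNIV \<rightarrow>\<^sub>E space ?B"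
        using \<omega>0_mem by (auto simp: ext_def space_PiM space_restrict_space PiE_def Pi_def)
    qed
    then show ?thesis by (simp add: measurable_cong_sets[OF refl sets_P])
  qed
  have "indep_var (PiM A (\<lambda>_. ?B)) (\<lambda>\<omega>. restrict \<omega> A) (PiM B (\<lambda>_. ?B)) (\<lambda>\<omega>. restrict \<omega> B)"
    using indep_var_restrict[OF indep_coordinates \<open>A \<inter> B = {}\<close>] by simp
  then have ind: "indep_var borel ((f \<circ> ext A) \<circ> (\<lambda>\<omega>. restrict \<omega> A)) borel ((g \<circ> ext B) \<circ> (\<lambda>\<omega>. restrict \<omega> B))"
    by (rule indep_var_compose)
      (auto intro: measurable_comp[OF ext] observable_measurable[OF f] observable_measurable[OF g])
  have frozen: "((h \<circ> ext C) \<circ> (\<lambda>\<omega>. restrict \<omega> C)) \<omega> = h \<omega>" if "observable C h" "\<omega> \<in> space P" for h C \<omega>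
  proof -
    have "ext C (restrict \<omega> C) \<in> space P"
      using that(2) \<omega>0 by (auto simp: mem_space_P ext_def)
    moreover have "\<forall>n\<in>C. ext C (restrict \<omega> C) n = \<omega> n" by (simp add: ext_def)
    ultimately show ?thesis using observableD[OF that(1) _ that(2)] unfolding comp_def by simp
  qed
  let ?f = "(f \<circ> ext A) \<circ> (\<lambda>\<omega>. restrict \<omega> A)" and ?g = "(g \<circ> ext B) \<circ> (\<lambda>\<omega>. restrict \<omega> B)"
  have int: "integrable P ?f" "integrable P ?g"
    by (rule Bochner_Integration.integrable_cong[THEN iffD1, OF refl _ observable_integrable[OF f]],
        simp only: frozen[OF f])
      (rule Bochner_Integration.integrable_cong[THEN iffD1, OF refl _ observable_integrable[OF g]],
        simp only: frozen[OF g])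
  have "expectation (\<lambda>\<omega>. f \<omega> * g \<omega>) = expectation (\<lambda>\<omega>. ?f \<omega> * ?g \<omega>)"
    by (rule Bochner_Integration.integral_cong) (simp_all only: frozen[OF f] frozen[OF g])
  also have "\<dots> = expectation ?f * expectation ?g"
    by (rule indep_var_lebesgue_integral[OF ind int])
  also have "expectation ?f = expectation f"
    by (rule Bochner_Integration.integral_cong) (simp_all only: frozen[OF f])
  also have "expectation ?g = expectation g"
    by (rule Bochner_Integration.integral_cong) (simp_all only: frozen[OF g])
  finally show ?thesis .
qed

section \<open>Tilting the disorder\<close>

text \<open>This is the Gibbs variational inequality for the tilted law with density \<open>\<rho>\<close>; integrating
  the tangent line of the exponential at the right point avoids introducing that law.\<close>

lemma exp_tilted_expectation_le:
  assumes X: "observable UNIV X" and \<rho>: "observable UNIV \<rho>" and L: "observable UNIV (\<lambda>\<omega>. ln (\<rho> \<omega>))"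
    and pos: "\<And>\<omega>. \<omega> \<in> space P \<Longrightarrow> \<rho> \<omega> > 0" and one: "expectation \<rho> = 1"
  shows "exp (expectation (\<lambda>\<omega>. \<rho> \<omega> * X \<omega>) - expectation (\<lambda>\<omega>. \<rho> \<omega> * ln (\<rho> \<omega>)))
    \<le> expectation (\<lambda>\<omega>. exp (X \<omega>))"
proof -
  define a where "a = expectation (\<lambda>\<omega>. \<rho> \<omega> * X \<omega>) - expectation (\<lambda>\<omega>. \<rho> \<omega> * ln (\<rho> \<omega>))"
  have i1: "integrable P \<rho>" and i2: "integrable P (\<lambda>\<omega>. \<rho> \<omega> * X \<omega>)"
    and i3: "integrable P (\<lambda>\<omega>. \<rho> \<omega> * ln (\<rho> \<omega>))"
    by (intro observable_integrable[of UNIV] observable_mult X \<rho> L)+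
  obtain K where "K \<ge> 0" and K: "\<And>\<omega>. \<omega> \<in> space P \<Longrightarrow> \<bar>X \<omega>\<bar> \<le> K"
    by (rule observable_bound[OF X]) blast
  have "observable UNIV (\<lambda>\<omega>. exp (X \<omega>))"
  proof (rule observable_compose[OF X, where K = "exp K"])
    show "(\<lambda>\<omega>. exp (X \<omega>)) \<in> borel_measurable P"
      using observable_measurable[OF X] by measurable
    show "\<bar>exp (X \<omega>)\<bar> \<le> exp K" if "\<omega> \<in> space P" for \<omega>
      using K[OF that] by simp
  qed
  then have i4: "integrable P (\<lambda>\<omega>. exp (X \<omega>))" by (rule observable_integrable)
  have "expectation (\<lambda>\<omega>. \<rho> \<omega> * X \<omega> - \<rho> \<omega> * ln (\<rho> \<omega>) + (1 - a) * \<rho> \<omega>) = a + (1 - a) * expectation \<rho>"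
    using i1 i2 i3 unfolding a_def by simp
  then have "exp a = expectation (\<lambda>\<omega>. exp a * (\<rho> \<omega> * X \<omega> - \<rho> \<omega> * ln (\<rho> \<omega>) + (1 - a) * \<rho> \<omega>))"
    by (simp add: one)
  also have "\<dots> \<le> expectation (\<lambda>\<omega>. exp (X \<omega>))"
  proof (rule integral_mono[OF _ i4])
    show "integrable P (\<lambda>\<omega>. exp a * (\<rho> \<omega> * X \<omega> - \<rho> \<omega> * ln (\<rho> \<omega>) + (1 - a) * \<rho> \<omega>))"
      using i1 i2 i3 by simp
    fix \<omega> assume \<omega>: "\<omega> \<in> space P"
    let ?y = "X \<omega> - ln (\<rho> \<omega>)"
    have "exp a * (\<rho> \<omega> * X \<omega> - \<rho> \<omega> * ln (\<rho> \<omega>) + (1 - a) * \<rho> \<omega>) = \<rho> \<omega> * (exp a * (1 + (?y - a)))"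
      by (simp add: algebra_simps)
    also have "\<dots> \<le> \<rho> \<omega> * (exp a * exp (?y - a))"
      using pos[OF \<omega>] by (intro mult_left_mono exp_ge_add_one_self) auto
    also have "\<dots> = exp (X \<omega>)"
      using pos[OF \<omega>] by (simp add: exp_diff)
    finally show "exp a * (\<rho> \<omega> * X \<omega> - \<rho> \<omega> * ln (\<rho> \<omega>) + (1 - a) * \<rho> \<omega>) \<le> exp (X \<omega>)" .
  qed
  finally show ?thesis by (simp add: a_def)
qed

text \<open>Each factor lives on its own block of sites, away from the others and from \<open>f\<close>, so the factors
  of mean 1 can be integrated out one at a time.\<close>

lemma expectation_prod_disjoint_translates:
  assumes "finite S" and r: "observable B r" and one: "expectation r = 1"
    and sep: "\<And>x y. x \<in> S \<Longrightarrow> y \<in> S \<Longrightarrow> x \<noteq> y \<Longrightarrow> ((+) x ` B) \<inter> ((+) y ` B) = {}"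
    and f: "observable C f" and C: "\<And>x. x \<in> S \<Longrightarrow> ((+) x ` B) \<inter> C = {}"
  shows "expectation (\<lambda>\<omega>. (\<Prod>x\<in>S. r (theta x \<omega>)) * f \<omega>) = expectation f"
  using assms(1) sep C
proof (induction S rule: finite_induct)
  case empty
  show ?case by simp
next
  case (insert x S)
  let ?D = "(\<Union>y\<in>S. (+) y ` B) \<union> C"
  have rest: "observable ?D (\<lambda>\<omega>. (\<Prod>y\<in>S. r (theta y \<omega>)) * f \<omega>)"
    by (intro observable_mult observable_prod observable_mono[OF observable_theta[OF r]]
        observable_mono[OF f]) auto
  have "((+) x ` B) \<inter> ?D = {}"
  proof -
    have "((+) x ` B) \<inter> ((+) y ` B) = {}" if "y \<in> S" for y
      using insert.hyps(2) that by (intro insert.prems(1)) auto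
    moreover have "((+) x ` B) \<inter> C = {}" by (intro insert.prems(2)) simp
    ultimately show ?thesis by blast
  qed
  note indep = expectation_mult_disjoint[OF observable_theta[OF r] rest this]
  have IH: "expectation (\<lambda>\<omega>. (\<Prod>y\<in>S. r (theta y \<omega>)) * f \<omega>) = expectation f"
    by (rule insert.IH) (intro insert.prems; simp)+
  have "expectation (\<lambda>\<omega>. (\<Prod>y\<in>insert x S. r (theta y \<omega>)) * f \<omega>)
      = expectation (\<lambda>\<omega>. r (theta x \<omega>) * ((\<Prod>y\<in>S. r (theta y \<omega>)) * f \<omega>))"
    using insert.hyps by (simp add: mult.assoc)
  also have "\<dots> = expectation f"
    by (simp only: indep IH expectation_theta[OF observable_measurable[OF r]] one mult_1)
  finally show ?case .
qed

lemma theta_add: "theta m (theta n \<omega>) = theta (n + m) \<omega>"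
  by (simp add: theta_def add.assoc)

text \<open>The tilted law has density \<open>\<Prod>x\<in>J. 1 + h(\<theta>\<^sub>x \<omega>)\<close>.  Because the translates are so far apart that
  no term \<open>F(\<theta>\<^sub>n \<omega>)\<close> sees two of them, the mean of every term changes exactly by the sum of the
  individual correlations with the factors, and both the gain and the entropy are proportional to
  the number of factors.\<close>

lemma expectation_exp_sum_ge:
  assumes h: "observable B h" and h_small: "\<And>\<omega>. \<omega> \<in> space P \<Longrightarrow> \<bar>h \<omega>\<bar> \<le> 1/2" and Eh: "expectation h = 0"
    and F: "observable A F" and EF: "expectation F = 0"
    and "finite J" "finite V"
    and disj: "\<And>x y. x \<in> J \<Longrightarrow> y \<in> J \<Longrightarrow> x \<noteq> y \<Longrightarrow> ((+) x ` B) \<inter> ((+) y ` B) = {}"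
    and sep: "\<And>n x y. x \<in> J \<Longrightarrow> y \<in> J \<Longrightarrow> x \<noteq> y \<Longrightarrow>
      ((+) x ` B) \<inter> ((+) n ` A) = {} \<or> ((+) y ` B) \<inter> ((+) n ` A) = {}"
    and T: "\<And>m. B \<inter> ((+) m ` A) \<noteq> {} \<Longrightarrow> m \<in> T"
    and TV: "\<And>x. x \<in> J \<Longrightarrow> (+) x ` T \<subseteq> V"
  shows "exp (real (card J) * ((\<Sum>m\<in>T. expectation (\<lambda>\<omega>. h \<omega> * F (theta m \<omega>))) - expectation (\<lambda>\<omega>. (h \<omega>)\<^sup>2)))
    \<le> expectation (\<lambda>\<omega>. exp (\<Sum>n\<in>V. F (theta n \<omega>)))"
proof -
  define w where "w = (\<Sum>m\<in>T. expectation (\<lambda>\<omega>. h \<omega> * F (theta m \<omega>)))"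
  define r where "r = (\<lambda>\<omega>. 1 + h \<omega>)"
  define \<rho> where "\<rho> = (\<lambda>\<omega>. \<Prod>x\<in>J. r (theta x \<omega>))"
  have r: "observable B r" unfolding r_def by (intro observable_add observable_const h)
  have r_ge: "r \<omega> \<ge> 1/2" and r_le: "r \<omega> \<le> 3/2" if "\<omega> \<in> space P" for \<omega>
    using h_small[OF that] by (auto simp: r_def abs_le_iff)
  have Er: "expectation r = 1"
    unfolding r_def using observable_integrable[OF h] by (simp add: Eh prob_space)
  have ln_r: "observable B (\<lambda>\<omega>. ln (r \<omega>))"
  proof (rule observable_compose[OF r, where K = 1])
    show "(\<lambda>\<omega>. ln (r \<omega>)) \<in> borel_measurable P"
      using observable_measurable[OF r] by measurable
    show "\<bar>ln (r \<omega>)\<bar> \<le> 1" if "\<omega> \<in> space P" for \<omega>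
    proof -
      have "ln (r \<omega>) \<le> r \<omega> - 1" using r_ge[OF that] by (intro ln_le_minus_one) auto
      moreover have "ln (1 / r \<omega>) \<le> 1 / r \<omega> - 1" using r_ge[OF that] by (intro ln_le_minus_one) auto
      moreover have "1 / r \<omega> \<le> 2" using r_ge[OF that] by (simp add: field_simps)
      ultimately show ?thesis using r_le[OF that] r_ge[OF that] by (simp add: ln_div)
    qed
  qed
  have Fn: "observable ((+) n ` A) (\<lambda>\<omega>. F (theta n \<omega>))" for n
    by (rule observable_theta[OF F])
  have hx: "observable ((+) x ` B) (\<lambda>\<omega>. h (theta x \<omega>))" for x
    by (rule observable_theta[OF h])
  have rx: "observable ((+) x ` B) (\<lambda>\<omega>. r (theta x \<omega>))" for x
    by (rule observable_theta[OF r])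
  have ln_rx: "observable ((+) x ` B) (\<lambda>\<omega>. ln (r (theta x \<omega>)))" for x
    by (rule observable_theta[OF ln_r])
  have \<rho>_obs: "observable UNIV \<rho>"
    unfolding \<rho>_def by (intro observable_prod observable_mono[OF rx]) auto
  have r_pos: "r (theta x \<omega>) > 0" if "\<omega> \<in> space P" for x \<omega>
    using r_ge[OF theta_space[OF that]] by (rule less_le_trans[rotated]) simp
  have \<rho>_pos: "\<rho> \<omega> > 0" if "\<omega> \<in> space P" for \<omega>
    unfolding \<rho>_def using r_pos[OF that] by (intro prod_pos) auto
  have ln_\<rho>: "ln (\<rho> \<omega>) = (\<Sum>x\<in>J. ln (r (theta x \<omega>)))" if "\<omega> \<in> space P" for \<omega>
    unfolding \<rho>_def using r_pos[OF that] \<open>finite J\<close> by (intro ln_prod) (auto simp: less_le)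
  have sum_ln_obs: "observable UNIV (\<lambda>\<omega>. \<Sum>x\<in>J. ln (r (theta x \<omega>)))"
    by (intro observable_sum observable_mono[OF ln_rx]) auto
  have ln_\<rho>_obs: "observable UNIV (\<lambda>\<omega>. ln (\<rho> \<omega>))"
  proof -
    obtain K where "K \<ge> 0" and K: "\<And>\<omega>. \<omega> \<in> space P \<Longrightarrow> \<bar>\<Sum>x\<in>J. ln (r (theta x \<omega>))\<bar> \<le> K"
      by (rule observable_bound[OF sum_ln_obs]) blast
    show ?thesis
      by (rule observable_compose[OF \<rho>_obs, where K = K])
        (use observable_measurable[OF \<rho>_obs] K in \<open>simp_all add: ln_\<rho>\<close>)
  qed
  have E\<rho>: "expectation \<rho> = 1"
    using expectation_prod_disjoint_translates[OF \<open>finite J\<close> r Er disj observable_const[of "{}" 1]]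
    by (simp add: \<rho>_def prob_space)
  \<comment> \<open>An observable that sees at most one of the translates only feels that factor of \<open>\<rho>\<close>.\<close>
  have one_factor: "expectation (\<lambda>\<omega>. \<rho> \<omega> * f \<omega>) = expectation (\<lambda>\<omega>. r (theta x \<omega>) * f \<omega>)"
    if "x \<in> J" and f: "observable C f"
      and C: "\<And>y. y \<in> J \<Longrightarrow> y \<noteq> x \<Longrightarrow> ((+) y ` B) \<inter> C = {}" for x f C
  proof -
    have "\<rho> \<omega> * f \<omega> = (\<Prod>y\<in>J - {x}. r (theta y \<omega>)) * (r (theta x \<omega>) * f \<omega>)" for \<omega>
      unfolding \<rho>_def prod.remove[OF \<open>finite J\<close> \<open>x \<in> J\<close>] by (simp only: ac_simps)
    moreover have "expectation (\<lambda>\<omega>. (\<Prod>y\<in>J - {x}. r (theta y \<omega>)) * (r (theta x \<omega>) * f \<omega>))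
        = expectation (\<lambda>\<omega>. r (theta x \<omega>) * f \<omega>)"
    proof (rule expectation_prod_disjoint_translates[OF _ r Er])
      show "observable ((+) x ` B \<union> C) (\<lambda>\<omega>. r (theta x \<omega>) * f \<omega>)"
        by (intro observable_mult observable_mono[OF rx] observable_mono[OF f]) auto
      show "((+) y ` B) \<inter> ((+) x ` B \<union> C) = {}" if "y \<in> J - {x}" for y
        using disj[of y x] C[of y] that \<open>x \<in> J\<close> by (simp add: Int_Un_distrib)
    qed (use \<open>finite J\<close> disj in auto)
    ultimately show ?thesis by presburger
  qed
  have corr0: "expectation (\<lambda>\<omega>. h (theta x \<omega>) * F (theta n \<omega>)) = 0"
    if "((+) x ` B) \<inter> ((+) n ` A) = {}" for x n
    using expectation_mult_disjoint[OF hx Fn that] EF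
    by (simp add: expectation_theta[OF observable_measurable[OF F]])
  have mean: "expectation (\<lambda>\<omega>. \<rho> \<omega> * F (theta n \<omega>))
      = (\<Sum>x\<in>J. expectation (\<lambda>\<omega>. h (theta x \<omega>) * F (theta n \<omega>)))" for n
  proof (cases "\<exists>x\<in>J. ((+) x ` B) \<inter> ((+) n ` A) \<noteq> {}")
    case True
    then obtain x where x: "x \<in> J" "((+) x ` B) \<inter> ((+) n ` A) \<noteq> {}" by blast
    have others: "((+) y ` B) \<inter> ((+) n ` A) = {}" if "y \<in> J" "y \<noteq> x" for y
      using sep[OF x(1) that(1), of n] that(2) x(2) by blast
    have i: "integrable P (\<lambda>\<omega>. F (theta n \<omega>))" "integrable P (\<lambda>\<omega>. h (theta x \<omega>) * F (theta n \<omega>))"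
      by (intro observable_integrable[of UNIV] observable_mult observable_mono[OF Fn] observable_mono[OF hx]; simp)+
    have "expectation (\<lambda>\<omega>. \<rho> \<omega> * F (theta n \<omega>)) = expectation (\<lambda>\<omega>. r (theta x \<omega>) * F (theta n \<omega>))"
      by (rule one_factor[OF x(1) Fn others])
    also have "\<dots> = expectation (\<lambda>\<omega>. F (theta n \<omega>) + h (theta x \<omega>) * F (theta n \<omega>))"
      by (simp add: r_def algebra_simps)
    also have "\<dots> = expectation (\<lambda>\<omega>. h (theta x \<omega>) * F (theta n \<omega>))"
      using i by (simp add: expectation_theta[OF observable_measurable[OF F]] EF)
    also have "\<dots> = (\<Sum>y\<in>J. expectation (\<lambda>\<omega>. h (theta y \<omega>) * F (theta n \<omega>)))"
      using others corr0 unfolding sum.remove[OF \<open>finite J\<close> x(1)] by simp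
    finally show ?thesis .
  next
    case False
    then have "expectation (\<lambda>\<omega>. \<rho> \<omega> * F (theta n \<omega>)) = expectation (\<lambda>\<omega>. F (theta n \<omega>))"
      unfolding \<rho>_def
      by (intro expectation_prod_disjoint_translates[OF \<open>finite J\<close> r Er disj Fn]) blast+
    with False show ?thesis
      by (simp add: corr0 expectation_theta[OF observable_measurable[OF F]] EF)
  qed
  have gain: "(\<Sum>n\<in>V. expectation (\<lambda>\<omega>. h (theta x \<omega>) * F (theta n \<omega>))) = w" if "x \<in> J" for x
  proof -
    have "(\<Sum>n\<in>V. expectation (\<lambda>\<omega>. h (theta x \<omega>) * F (theta n \<omega>)))
        = (\<Sum>n\<in>(+) x ` T. expectation (\<lambda>\<omega>. h (theta x \<omega>) * F (theta n \<omega>)))"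
    proof (rule sum.mono_neutral_right[OF \<open>finite V\<close> TV[OF that]], intro ballI corr0)
      fix n assume "n \<in> V - (+) x ` T"
      then have "n - x \<notin> T" by (auto simp: image_iff dest!: bspec[of _ _ "n - x"])
      then have "B \<inter> ((+) (n - x) ` A) = {}" using T by blast
      then show "((+) x ` B) \<inter> ((+) n ` A) = {}"
        by (force simp: algebra_simps)
    qed
    also have "\<dots> = (\<Sum>m\<in>T. expectation (\<lambda>\<omega>. h (theta x \<omega>) * F (theta (x + m) \<omega>)))"
      by (subst sum.reindex) (auto simp: inj_on_def)
    also have "\<dots> = w"
      unfolding w_def
    proof (rule sum.cong[OF refl])
      fix m
      have "(\<lambda>\<omega>. h \<omega> * F (theta m \<omega>)) \<in> borel_measurable P"
        using observable_measurable[OF h] observable_measurable[OF Fn] by measurable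
      from expectation_theta[OF this, of x]
      show "expectation (\<lambda>\<omega>. h (theta x \<omega>) * F (theta (x + m) \<omega>)) = expectation (\<lambda>\<omega>. h \<omega> * F (theta m \<omega>))"
        by (simp add: theta_add)
    qed
    finally show ?thesis .
  qed
  have entropy: "expectation (\<lambda>\<omega>. \<rho> \<omega> * ln (r (theta x \<omega>))) \<le> expectation (\<lambda>\<omega>. (h \<omega>)\<^sup>2)" if "x \<in> J" for x
  proof -
    have m: "(\<lambda>\<omega>. r \<omega> * ln (r \<omega>)) \<in> borel_measurable P"
      using observable_measurable[OF r] by measurable
    have h2: "observable B (\<lambda>\<omega>. (h \<omega>)\<^sup>2)"
      unfolding power2_eq_square by (intro observable_mult h)
    have "expectation (\<lambda>\<omega>. \<rho> \<omega> * ln (r (theta x \<omega>))) = expectation (\<lambda>\<omega>. r (theta x \<omega>) * ln (r (theta x \<omega>)))"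
      by (rule one_factor[OF that ln_rx disj]) (use that in auto)
    also have "\<dots> = expectation (\<lambda>\<omega>. r \<omega> * ln (r \<omega>))"
      by (rule expectation_theta[OF m])
    also have "\<dots> \<le> expectation (\<lambda>\<omega>. h \<omega> + (h \<omega>)\<^sup>2)"
    proof (rule integral_mono)
      show "integrable P (\<lambda>\<omega>. r \<omega> * ln (r \<omega>))" "integrable P (\<lambda>\<omega>. h \<omega> + (h \<omega>)\<^sup>2)"
        by (intro observable_integrable[of B] observable_mult observable_add r ln_r h h2)+
      fix \<omega> assume \<omega>: "\<omega> \<in> space P"
      have "r \<omega> * ln (r \<omega>) \<le> r \<omega> * (r \<omega> - 1)"
        using r_ge[OF \<omega>] by (intro mult_left_mono ln_le_minus_one) auto
      then show "r \<omega> * ln (r \<omega>) \<le> h \<omega> + (h \<omega>)\<^sup>2"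
        by (simp add: r_def algebra_simps power2_eq_square)
    qed
    also have "\<dots> = expectation (\<lambda>\<omega>. (h \<omega>)\<^sup>2)"
      using observable_integrable[OF h] observable_integrable[OF h2] by (simp add: Eh)
    finally show ?thesis .
  qed
  have "expectation (\<lambda>\<omega>. \<rho> \<omega> * (\<Sum>n\<in>V. F (theta n \<omega>))) = (\<Sum>n\<in>V. expectation (\<lambda>\<omega>. \<rho> \<omega> * F (theta n \<omega>)))"
    unfolding sum_distrib_left
    by (intro Bochner_Integration.integral_sum observable_integrable[of UNIV] observable_mult \<rho>_obs observable_mono[OF Fn]) auto
  also have "\<dots> = (\<Sum>x\<in>J. \<Sum>n\<in>V. expectation (\<lambda>\<omega>. h (theta x \<omega>) * F (theta n \<omega>)))"
    unfolding mean by (rule sum.swap)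
  also have "\<dots> = real (card J) * w" by (simp add: gain)
  finally have E1: "expectation (\<lambda>\<omega>. \<rho> \<omega> * (\<Sum>n\<in>V. F (theta n \<omega>))) = real (card J) * w" .
  have "expectation (\<lambda>\<omega>. \<rho> \<omega> * ln (\<rho> \<omega>)) = expectation (\<lambda>\<omega>. \<Sum>x\<in>J. \<rho> \<omega> * ln (r (theta x \<omega>)))"
    by (rule Bochner_Integration.integral_cong) (simp_all add: ln_\<rho> sum_distrib_left)
  also have "\<dots> = (\<Sum>x\<in>J. expectation (\<lambda>\<omega>. \<rho> \<omega> * ln (r (theta x \<omega>))))"
    by (intro Bochner_Integration.integral_sum observable_integrable[of UNIV] observable_mult \<rho>_obs observable_mono[OF ln_rx]) auto
  also have "\<dots> \<le> real (card J) * expectation (\<lambda>\<omega>. (h \<omega>)\<^sup>2)"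
    by (intro sum_bounded_above entropy)
  finally have E2: "expectation (\<lambda>\<omega>. \<rho> \<omega> * ln (\<rho> \<omega>)) \<le> real (card J) * expectation (\<lambda>\<omega>. (h \<omega>)\<^sup>2)" .
  have X: "observable UNIV (\<lambda>\<omega>. \<Sum>n\<in>V. F (theta n \<omega>))"
    by (intro observable_sum observable_mono[OF Fn]) auto
  have "exp (real (card J) * (w - expectation (\<lambda>\<omega>. (h \<omega>)\<^sup>2)))
      \<le> exp (expectation (\<lambda>\<omega>. \<rho> \<omega> * (\<Sum>n\<in>V. F (theta n \<omega>))) - expectation (\<lambda>\<omega>. \<rho> \<omega> * ln (\<rho> \<omega>)))"
    using E1 E2 by (simp add: algebra_simps)
  also have "\<dots> \<le> expectation (\<lambda>\<omega>. exp (\<Sum>n\<in>V. F (theta n \<omega>)))"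
    by (rule exp_tilted_expectation_le[OF X \<rho>_obs ln_\<rho>_obs \<rho>_pos E\<rho>])
  finally show ?thesis by (simp only: w_def)
qed

end

section \<open>Boxes\<close>

lemma mem_box_V: "n \<in> box_V N \<longleftrightarrow> (\<forall>i. 2 * \<bar>n $ i\<bar> \<le> int N)"
proof -
  have "(- (real N / 2) \<le> real_of_int k \<and> real_of_int k \<le> real N / 2) \<longleftrightarrow> 2 * \<bar>k\<bar> \<le> int N" for k :: int
  proof -
    have "(- (real N / 2) \<le> real_of_int k \<and> real_of_int k \<le> real N / 2)
        \<longleftrightarrow> real_of_int (2 * \<bar>k\<bar>) \<le> real_of_int (int N)" by (auto simp: abs_le_iff)
    then show ?thesis by (simp only: of_int_le_iff)
  qed
  then show ?thesis by (simp add: box_V_def)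
qed

lemma box_V_add:
  assumes "n \<in> box_V a" "m \<in> box_V b" shows "n + m \<in> box_V (a + b)"
  unfolding mem_box_V
proof
  fix i
  have "2 * \<bar>n $ i\<bar> \<le> int a" "2 * \<bar>m $ i\<bar> \<le> int b" using assms by (simp_all add: mem_box_V)
  then show "2 * \<bar>(n + m) $ i\<bar> \<le> int (a + b)" 
    using abs_triangle_ineq[of "n $ i" "m $ i"] by simp
qed

lemma box_V_diff:
  assumes "n \<in> box_V a" "m \<in> box_V b" shows "n - m \<in> box_V (a + b)"
  unfolding mem_box_V
proof
  fix i
  have "2 * \<bar>n $ i\<bar> \<le> int a" "2 * \<bar>m $ i\<bar> \<le> int b" using assms by (simp_all add: mem_box_V)
  then show "2 * \<bar>(n - m) $ i\<bar> \<le> int (a + b)" 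
    using abs_triangle_ineq4[of "n $ i" "m $ i"] by simp
qed

lemma box_V_mono:
  assumes "a \<le> b" shows "box_V a \<subseteq> box_V b"
proof
  fix n :: "int ^ 'd" assume "n \<in> box_V a"
  then have "2 * \<bar>n $ i\<bar> \<le> int a" for i by (simp add: mem_box_V)
  moreover have "int a \<le> int b" using assms by simp
  ultimately show "n \<in> box_V b" unfolding mem_box_V using order_trans by blast
qed

text \<open>Viewing lattice points as functions of the coordinate makes the count of a cube an instance of
  the count of a function space.\<close>

lemma cube_eq_image: "{x :: 'a ^ 'd. \<forall>i. x $ i \<in> S} = vec_lambda ` (UNIV \<rightarrow>\<^sub>E S)"
proof (intro equalityI subsetI)
  fix x :: "'a ^ 'd" assume "x \<in> {x. \<forall>i. x $ i \<in> S}"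
  then have "vec_nth x \<in> UNIV \<rightarrow>\<^sub>E S" by auto
  then have "vec_lambda (vec_nth x) \<in> vec_lambda ` (UNIV \<rightarrow>\<^sub>E S)" by (rule imageI)
  then show "x \<in> vec_lambda ` (UNIV \<rightarrow>\<^sub>E S)" by simp
qed auto

lemma finite_cube: "finite S \<Longrightarrow> finite {x :: 'a ^ 'd::finite. \<forall>i. x $ i \<in> S}"
  unfolding cube_eq_image by (intro finite_imageI finite_PiE) auto

lemma card_cube: "card {x :: 'a ^ 'd::finite. \<forall>i. x $ i \<in> S} = card S ^ CARD('d)"
proof -
  have "inj_on (vec_lambda :: ('d \<Rightarrow> 'a) \<Rightarrow> _) (UNIV \<rightarrow>\<^sub>E S)"
    by (auto simp: inj_on_def vec_lambda_inject)
  then show ?thesis unfolding cube_eq_image by (simp add: card_image card_PiE)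
qed

lemma box_V_eq_cube: "box_V N = {x :: int ^ 'd. \<forall>i. x $ i \<in> {- int (N div 2)..int (N div 2)}}"
proof -
  have "2 * \<bar>k\<bar> \<le> int N \<longleftrightarrow> k \<in> {- int (N div 2)..int (N div 2)}" for k :: int
    unfolding atLeastAtMost_iff by linarith
  then show ?thesis by (simp only: set_eq_iff mem_Collect_eq mem_box_V simp_thms)
qed

lemma finite_box_V: "finite (box_V N :: (int ^ 'd::finite) set)"
  unfolding box_V_eq_cube by (rule finite_cube) simp

lemma card_box_V: "card (box_V N :: (int ^ 'd::finite) set) = (2 * (N div 2) + 1) ^ CARD('d)"
proof -
  have "card {- int k..int k} = 2 * k + 1" for k by simp
  then show ?thesis unfolding box_V_eq_cube card_cube by (simp only:)
qed

lemma finite_subset_box_V: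
  assumes "finite (A :: (int ^ 'd::finite) set)" obtains r where "A \<subseteq> box_V r"
proof -
  let ?r = "\<Sum>n\<in>A. \<Sum>i\<in>UNIV. nat (2 * \<bar>n $ i\<bar>)"
  have "n \<in> box_V ?r" if "n \<in> A" for n
    unfolding mem_box_V
  proof
    fix i
    have "nat (2 * \<bar>n $ i\<bar>) \<le> (\<Sum>i\<in>UNIV. nat (2 * \<bar>n $ i\<bar>))"
      by (rule member_le_sum) auto
    also have "\<dots> \<le> ?r"
      by (rule member_le_sum[OF that]) (use assms in auto)
    finally show "2 * \<bar>n $ i\<bar> \<le> int ?r" by linarith
  qed
  then show ?thesis by (intro that[of ?r]) auto
qed

text \<open>The boundary layer of fixed thickness has lower order than the volume.\<close>

lemma eventually_box_layer_le:
  assumes "c > 0"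
  shows "eventually (\<lambda>N. K * (real (card (box_V (N + 2 * r) :: (int ^ 'd::finite) set))
      - real (card (box_V N :: (int ^ 'd) set))) \<le> c * real N ^ CARD('d)) sequentially"
proof -
  let ?d = "CARD('d)"
  have "(\<lambda>N. \<bar>K\<bar> * ((1 + real (2 * r + 1) * inverse (real N)) ^ ?d - 1)) \<longlonglongrightarrow> \<bar>K\<bar> * ((1 + real (2 * r + 1) * 0) ^ ?d - 1)"
    by (intro tendsto_intros lim_inverse_n)
  then have "eventually (\<lambda>N. \<bar>K\<bar> * ((1 + real (2 * r + 1) * inverse (real N)) ^ ?d - 1) < c) sequentially"
    by (rule order_tendstoD) (use assms in auto)
  then show ?thesis
    using eventually_gt_at_top[of 0]
  proof eventually_elim
    case (elim N)
    let ?V = "real (card (box_V N :: (int ^ 'd) set))" and ?W = "real (card (box_V (N + 2 * r) :: (int ^ 'd) set))"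
    have W: "?W \<le> (real N + real (2 * r + 1)) ^ ?d"
    proof -
      have "2 * ((N + 2 * r) div 2) + 1 \<le> N + (2 * r + 1)" by simp
      then have "real (2 * ((N + 2 * r) div 2) + 1) \<le> real N + real (2 * r + 1)" by linarith
      then show ?thesis unfolding card_box_V of_nat_power by (rule power_mono) simp
    qed
    have V: "real N ^ ?d \<le> ?V"
    proof -
      have "N \<le> 2 * (N div 2) + 1" by simp
      then have "real N \<le> real (2 * (N div 2) + 1)" by linarith
      then show ?thesis unfolding card_box_V of_nat_power by (rule power_mono) simp
    qed
    have "?V \<le> ?W"
      by (simp add: card_mono finite_box_V box_V_mono)
    then have "K * (?W - ?V) \<le> \<bar>K\<bar> * (?W - ?V)" by (intro mult_right_mono) auto
    also have "\<dots> \<le> \<bar>K\<bar> * ((real N + real (2 * r + 1)) ^ ?d - real N ^ ?d)"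
      by (intro mult_left_mono diff_mono V W) simp
    also have "\<dots> = (\<bar>K\<bar> * ((1 + real (2 * r + 1) * inverse (real N)) ^ ?d - 1)) * real N ^ ?d"
    proof -
      have "real N + real (2 * r + 1) = (1 + real (2 * r + 1) * inverse (real N)) * real N"
        using elim by (simp add: field_simps)
      then show ?thesis by (simp only: power_mult_distrib) (simp add: algebra_simps)
    qed
    also have "\<dots> \<le> c * real N ^ ?d"
      using elim by (intro mult_right_mono) auto
    finally show ?case .
  qed
qed

section \<open>Exponential growth or negligible fluctuations\<close>

context iid_field
begin

text \<open>If some local observable is correlated with the total field \<open>\<Sum>n. F(\<theta>\<^sub>n \<omega>)\<close>, a small multiple of
  it is a profitable tilt: the gain is linear and the entropy quadratic in the multiple.  Placing
  it on a grid of fixed spacing uses a positive density of sites.\<close>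

lemma exponential_growth:
  assumes F: "observable A F" and EF: "expectation F = 0" and A: "A \<subseteq> box_V r"
    and h0: "observable (box_V b) h0"
    and corr: "(\<Sum>m\<in>box_V (b + r). expectation (\<lambda>\<omega>. h0 \<omega> * F (theta m \<omega>))) \<noteq> 0"
  shows "\<exists>c>0. eventually (\<lambda>N. exp (c * real N ^ CARD('d))
    \<le> expectation (\<lambda>\<omega>. exp (\<Sum>n\<in>box_V N. F (theta n \<omega>)))) sequentially"
proof -
  let ?T = "box_V (b + r) :: (int ^ 'd) set" and ?B = "box_V b :: (int ^ 'd) set"
  define w where "w = (\<Sum>m\<in>?T. expectation (\<lambda>\<omega>. h0 \<omega> * F (theta m \<omega>)))"
  define h1 where "h1 = (\<lambda>\<omega>. h0 \<omega> + - expectation h0)"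
  have h1: "observable ?B h1" unfolding h1_def by (intro observable_add h0 observable_const)
  have Eh1: "expectation h1 = 0"
    unfolding h1_def using observable_integrable[OF h0] by (simp add: prob_space)
  have corr1: "expectation (\<lambda>\<omega>. h1 \<omega> * F (theta m \<omega>)) = expectation (\<lambda>\<omega>. h0 \<omega> * F (theta m \<omega>))" for m
  proof -
    have "integrable P (\<lambda>\<omega>. F (theta m \<omega>))" "integrable P (\<lambda>\<omega>. h0 \<omega> * F (theta m \<omega>))"
      by (intro observable_integrable[of UNIV] observable_mult observable_mono[OF h0]
          observable_mono[OF observable_theta[OF F]]; simp)+
    then show ?thesis
      by (simp add: h1_def left_diff_distrib expectation_theta[OF observable_measurable[OF F]] EF)
  qed
  define s where "s = expectation (\<lambda>\<omega>. (h1 \<omega>)\<^sup>2)"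
  have "s \<ge> 0" unfolding s_def by (intro integral_nonneg_AE) auto
  have "\<bar>w\<bar> > 0" using corr by (simp add: w_def)
  obtain C where "C \<ge> 0" and C: "\<And>\<omega>. \<omega> \<in> space P \<Longrightarrow> \<bar>h1 \<omega>\<bar> \<le> C"
    by (rule observable_bound[OF h1]) blast
  \<comment> \<open>The first bound keeps the tilt below 1/2, the second keeps the entropy below the gain.\<close>
  define u where "u = min (1 / (2 * (C + 1))) (\<bar>w\<bar> / (2 * (s + 1)))"
  have "u > 0" using \<open>C \<ge> 0\<close> \<open>s \<ge> 0\<close> \<open>\<bar>w\<bar> > 0\<close> by (simp add: u_def)
  have uC: "u * C \<le> 1/2"
  proof -
    have "u * C \<le> 1 / (2 * (C + 1)) * C"
      using \<open>C \<ge> 0\<close> by (intro mult_right_mono) (simp_all add: u_def)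
    also have "\<dots> \<le> 1/2" using \<open>C \<ge> 0\<close> by (simp add: field_simps)
    finally show ?thesis .
  qed
  have us: "u * s < \<bar>w\<bar>"
  proof -
    have "u * s \<le> \<bar>w\<bar> / (2 * (s + 1)) * s"
      using \<open>s \<ge> 0\<close> by (intro mult_right_mono) (simp_all add: u_def)
    also have "\<dots> < \<bar>w\<bar>"
      using \<open>s \<ge> 0\<close> \<open>\<bar>w\<bar> > 0\<close> by (simp add: divide_less_eq algebra_simps add_nonneg_pos)
    finally show ?thesis .
  qed
  define h where "h = (\<lambda>\<omega>. sgn w * u * h1 \<omega>)"
  have h: "observable ?B h" unfolding h_def by (intro observable_mult observable_const h1)
  have h_small: "\<bar>h \<omega>\<bar> \<le> 1/2" if "\<omega> \<in> space P" for \<omega>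
  proof -
    have "\<bar>h \<omega>\<bar> = u * \<bar>h1 \<omega>\<bar>"
      using \<open>\<bar>w\<bar> > 0\<close> \<open>u > 0\<close> by (simp add: h_def abs_mult abs_sgn_eq)
    also have "\<dots> \<le> u * C" using C[OF that] \<open>u > 0\<close> by (intro mult_left_mono) auto
    finally show ?thesis using uC by linarith
  qed
  have Eh: "expectation h = 0" by (simp add: h_def Eh1)
  define \<gamma> where "\<gamma> = (\<Sum>m\<in>?T. expectation (\<lambda>\<omega>. h \<omega> * F (theta m \<omega>))) - expectation (\<lambda>\<omega>. (h \<omega>)\<^sup>2)"
  have "\<gamma> > 0"
  proof -
    have "(\<Sum>m\<in>?T. expectation (\<lambda>\<omega>. h \<omega> * F (theta m \<omega>))) = sgn w * u * w"
      by (simp add: h_def mult.assoc corr1 w_def sum_distrib_left)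
    also have "\<dots> = u * \<bar>w\<bar>" by (simp add: abs_sgn mult.commute mult.left_commute)
    finally have 1: "(\<Sum>m\<in>?T. expectation (\<lambda>\<omega>. h \<omega> * F (theta m \<omega>))) = u * \<bar>w\<bar>" .
    have "(sgn w)\<^sup>2 = 1" using \<open>\<bar>w\<bar> > 0\<close> by (simp add: sgn_if)
    then have "(h \<omega>)\<^sup>2 = u\<^sup>2 * (h1 \<omega>)\<^sup>2" for \<omega>
      by (simp add: h_def power_mult_distrib)
    then have "expectation (\<lambda>\<omega>. (h \<omega>)\<^sup>2) = u\<^sup>2 * s" by (simp add: s_def)
    then have 2: "expectation (\<lambda>\<omega>. (h \<omega>)\<^sup>2) = u * (u * s)" by (simp add: power2_eq_square)
    show ?thesis unfolding \<gamma>_def 1 2 using us \<open>u > 0\<close> by (simp add: right_diff_distrib[symmetric])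
  qed
  \<comment> \<open>The spacing exceeds the diameters of the block and of the support of \<open>F\<close> taken together.\<close>
  define M where "M = b + r + 1"
  define J where "J = (\<lambda>N. {x :: int ^ 'd. \<forall>i. x $ i \<in> (\<lambda>k. int M * int k) ` {..<N div (2 * M)}})"
  have card_J: "card (J N) = (N div (2 * M)) ^ CARD('d)" for N
    unfolding J_def card_cube by (subst card_image) (auto simp: inj_on_def M_def)
  have finite_J: "finite (J N)" for N
    unfolding J_def by (rule finite_cube) simp
  \<comment> \<open>A box of side \<open>2 (b + r)\<close> has radius \<open>b + r < M\<close>, and distinct grid points differ by at least \<open>M\<close> in some coordinate.\<close>
  have grid: "x = y" if xJ: "x \<in> J N" and yJ: "y \<in> J N" and xy: "x - y \<in> box_V (2 * (b + r))" for x y N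
  proof -
    have "x $ i = y $ i" for i
    proof -
      obtain k l where kl: "x $ i = int M * int k" "y $ i = int M * int l"
        using xJ yJ unfolding J_def by blast
      have half: "X \<le> int (b + r)" if "2 * X \<le> int (2 * (b + r))" for X :: int
        using that by simp
      have "\<bar>x $ i - y $ i\<bar> \<le> int (b + r)"
        using xy unfolding mem_box_V by (intro half) simp
      moreover have "\<bar>x $ i - y $ i\<bar> = int M * \<bar>int k - int l\<bar>"
        unfolding kl right_diff_distrib[symmetric] abs_mult by simp
      ultimately have "int M * \<bar>int k - int l\<bar> \<le> int (b + r)" by (simp only:)
      also have "\<dots> < int M * 1" by (simp add: M_def)
      finally have "int M * \<bar>int k - int l\<bar> < int M * 1" .
      then have "\<bar>int k - int l\<bar> < 1" by (rule mult_left_less_imp_less) simp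
      then show ?thesis by (simp add: kl)
    qed
    then show ?thesis by (simp add: vec_eq_iff)
  qed
  have bound: "exp (real (card (J N)) * \<gamma>) \<le> expectation (\<lambda>\<omega>. exp (\<Sum>n\<in>box_V N. F (theta n \<omega>)))" for N
    unfolding \<gamma>_def
  proof (rule expectation_exp_sum_ge[OF h h_small Eh F EF finite_J finite_box_V])
    fix x y assume xy: "x \<in> J N" "y \<in> J N" "x \<noteq> y"
    show "((+) x ` ?B) \<inter> ((+) y ` ?B) = {}"
    proof (rule ccontr)
      assume "((+) x ` ?B) \<inter> ((+) y ` ?B) \<noteq> {}"
      then obtain p q where "p \<in> ?B" "q \<in> ?B" "x + p = y + q" by auto
      moreover from this have "x = y + q - p" by (simp add: eq_diff_eq)
      ultimately have "x - y \<in> box_V (b + b)" using box_V_diff[of q b p b] by simp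
      also have "\<dots> \<subseteq> box_V (2 * (b + r))" by (rule box_V_mono) simp
      finally show False using grid[OF xy(1,2)] xy(3) by simp
    qed
    show "((+) x ` ?B) \<inter> ((+) n ` A) = {} \<or> ((+) y ` ?B) \<inter> ((+) n ` A) = {}" for n
    proof (rule ccontr)
      assume "\<not> (((+) x ` ?B) \<inter> ((+) n ` A) = {} \<or> ((+) y ` ?B) \<inter> ((+) n ` A) = {})"
      then obtain p a q a' where *: "p \<in> ?B" "a \<in> A" "x + p = n + a" "q \<in> ?B" "a' \<in> A" "y + q = n + a'"
        by blast
      have "(a - p) - (a' - q) \<in> box_V ((r + b) + (r + b))"
        using * A by (intro box_V_diff) auto
      moreover have "(r + b) + (r + b) = 2 * (b + r)" by simp
      moreover have "x = n + a - p" "y = n + a' - q" using *(3,6) by (simp_all add: eq_diff_eq)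
      then have "x - y = (a - p) - (a' - q)" by simp
      ultimately have "x - y \<in> box_V (2 * (b + r))" by (simp only:)
      then show False using grid[OF xy(1,2)] xy(3) by blast
    qed
  next
    fix m assume "?B \<inter> ((+) m ` A) \<noteq> {}"
    then obtain p a where *: "p \<in> ?B" "a \<in> A" "p = m + a" by blast
    then have "p - a \<in> ?T" using A by (intro box_V_diff) auto
    with * show "m \<in> ?T" by simp
  next
    fix x assume x: "x \<in> J N"
    show "(+) x ` ?T \<subseteq> box_V N"
    proof (clarify, unfold mem_box_V, rule)
      fix t :: "int ^ 'd" and i assume "\<forall>i. 2 * \<bar>t $ i\<bar> \<le> int (b + r)"
      then have t: "2 * \<bar>t $ i\<bar> \<le> int (b + r)" ..
      obtain k where k: "k < N div (2 * M)" "x $ i = int M * int k"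
        using x unfolding J_def by blast
      have "2 * M * (k + 1) \<le> 2 * M * (N div (2 * M))" using k(1) by (intro mult_le_mono2) simp
      also have "\<dots> \<le> N" by simp
      finally have "int (2 * M * (k + 1)) \<le> int N" by (simp only: of_nat_le_iff)
      then have 1: "2 * (int M * int k) + 2 * int M \<le> int N" by (simp add: algebra_simps)
      have 2: "\<bar>(x + t) $ i\<bar> \<le> int M * int k + \<bar>t $ i\<bar>"
        using abs_triangle_ineq[of "x $ i" "t $ i"] unfolding k(2) by (simp add: k(2))
      have 3: "2 * \<bar>t $ i\<bar> \<le> int M" by (rule order_trans[OF t]) (simp add: M_def)
      have "2 * c \<le> n" if "2 * a + 2 * m \<le> n" "c \<le> a + e" "2 * e \<le> m" "0 \<le> m" for a c e m n :: int
        using that by simp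
      from this[OF 1 2 3] show "2 * \<bar>(x + t) $ i\<bar> \<le> int N" by simp
    qed
  qed
  have "exp (\<gamma> / (4 * real M) ^ CARD('d) * real N ^ CARD('d)) \<le> expectation (\<lambda>\<omega>. exp (\<Sum>n\<in>box_V N. F (theta n \<omega>)))"
    if "N \<ge> 2 * M" for N
  proof -
    \<comment> \<open>Rounding down the number of grid points per direction loses at most a factor 2.\<close>
    have "M > 0" by (simp add: M_def)
    have "N div (2 * M) \<ge> 1" using that \<open>M > 0\<close> by (simp add: div_greater_zero_iff Suc_le_eq)
    then have "2 * M * 1 \<le> 2 * M * (N div (2 * M))" by (intro mult_le_mono2)
    moreover have "N < 2 * M * (N div (2 * M)) + 2 * M"
      using \<open>M > 0\<close> by (metis dividend_less_times_div mult_pos_pos zero_less_numeral add.commute)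
    ultimately have "N \<le> 2 * M * (N div (2 * M)) + 2 * M * (N div (2 * M))" by linarith
    then have "N \<le> 4 * M * (N div (2 * M))" by simp
    then have "real N \<le> real (4 * M * (N div (2 * M)))" by (simp only: of_nat_le_iff)
    then have "real N ^ CARD('d) \<le> (4 * real M * real (N div (2 * M))) ^ CARD('d)"
      by (intro power_mono) simp_all
    then have "real N ^ CARD('d) \<le> (4 * real M) ^ CARD('d) * real (card (J N))"
      by (simp add: power_mult_distrib card_J)
    then have "real N ^ CARD('d) / (4 * real M) ^ CARD('d) \<le> real (card (J N))"
      using \<open>M > 0\<close> by (simp add: divide_le_eq mult.commute)
    then have "\<gamma> * (real N ^ CARD('d) / (4 * real M) ^ CARD('d)) \<le> \<gamma> * real (card (J N))"
      using \<open>\<gamma> > 0\<close> by (intro mult_left_mono) auto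
    then have "exp (\<gamma> / (4 * real M) ^ CARD('d) * real N ^ CARD('d)) \<le> exp (real (card (J N)) * \<gamma>)"
      by (simp add: mult.commute)
    also note bound
    finally show ?thesis .
  qed
  moreover have "\<gamma> / (4 * real M) ^ CARD('d) > 0" using \<open>\<gamma> > 0\<close> by (simp add: M_def)
  ultimately show ?thesis unfolding eventually_sequentially by blast
qed

text \<open>In the absence of correlations, test against the indicator \<open>h\<close> of the event that the sum over
  the box is very negative: the terms in the box and those of a boundary layer have opposite
  correlations with \<open>h\<close>, and those of the layer are at most its size times \<open>K\<close> times the
  probability of the event.\<close>

lemma boundary_lower_bound:
  assumes F: "observable A F" and A: "A \<subseteq> box_V r"
    and K: "\<And>\<omega>. \<omega> \<in> space P \<Longrightarrow> \<bar>F \<omega>\<bar> \<le> K"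
    and uncorr: "\<And>b h. observable (box_V b) h \<Longrightarrow>
      (\<Sum>m\<in>box_V (b + r). expectation (\<lambda>\<omega>. h \<omega> * F (theta m \<omega>))) = 0"
  shows "AE \<omega> in P. - K * (real (card (box_V (N + 2 * r) :: (int ^ 'd) set)) - real (card (box_V N :: (int ^ 'd) set)))
    \<le> (\<Sum>n\<in>box_V N. F (theta n \<omega>))"
proof -
  let ?V = "box_V N :: (int ^ 'd) set" and ?W = "box_V (N + 2 * r) :: (int ^ 'd) set"
  define \<delta> where "\<delta> = real (card ?W) - real (card ?V)"
  have VW: "?V \<subseteq> ?W" by (rule box_V_mono) simp
  have layer: "real (card (?W - ?V)) = \<delta>"
    using VW by (simp add: \<delta>_def card_Diff_subset finite_box_V card_mono of_nat_diff)
  define G where "G = (\<lambda>\<omega>. \<Sum>n\<in>?V. F (theta n \<omega>))"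
  have Fn: "observable ((+) n ` A) (\<lambda>\<omega>. F (theta n \<omega>))" for n
    by (rule observable_theta[OF F])
  have G: "observable (box_V (N + r)) G"
    unfolding G_def
  proof (rule observable_sum, rule observable_mono[OF Fn])
    fix n assume "n \<in> ?V"
    then show "(+) n ` A \<subseteq> box_V (N + r)" using A by (auto intro: box_V_add)
  qed
  define h where "h = (\<lambda>\<omega>. of_bool (G \<omega> < - K * \<delta>) :: real)"
  have h: "observable (box_V (N + r)) h"
    unfolding h_def
  proof (rule observable_compose[OF G, where K = 1])
    show "(\<lambda>\<omega>. of_bool (G \<omega> < - K * \<delta>) :: real) \<in> borel_measurable P"
      using observable_measurable[OF G] by measurable
  qed simp
  have hF: "integrable P (\<lambda>\<omega>. h \<omega> * F (theta n \<omega>))" for n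
    by (intro observable_integrable[of UNIV] observable_mult observable_mono[OF Fn] observable_mono[OF h]) auto
  have "0 = (\<Sum>n\<in>?W. expectation (\<lambda>\<omega>. h \<omega> * F (theta n \<omega>)))"
    using uncorr[OF h] by (simp add: add.assoc mult_2)
  also have "\<dots> = (\<Sum>n\<in>?W - ?V. expectation (\<lambda>\<omega>. h \<omega> * F (theta n \<omega>)))
      + (\<Sum>n\<in>?V. expectation (\<lambda>\<omega>. h \<omega> * F (theta n \<omega>)))"
    by (rule sum.subset_diff[OF VW finite_box_V])
  also have "(\<Sum>n\<in>?V. expectation (\<lambda>\<omega>. h \<omega> * F (theta n \<omega>))) = expectation (\<lambda>\<omega>. h \<omega> * G \<omega>)"
    unfolding G_def sum_distrib_left by (rule Bochner_Integration.integral_sum[symmetric]) (rule hF)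
  also have "(\<Sum>n\<in>?W - ?V. expectation (\<lambda>\<omega>. h \<omega> * F (theta n \<omega>))) \<le> real (card (?W - ?V)) * (K * expectation h)"
  proof (rule sum_bounded_above)
    fix n
    have "expectation (\<lambda>\<omega>. h \<omega> * F (theta n \<omega>)) \<le> expectation (\<lambda>\<omega>. K * h \<omega>)"
    proof (rule integral_mono[OF hF])
      show "integrable P (\<lambda>\<omega>. K * h \<omega>)" using observable_integrable[OF h] by simp
      fix \<omega> assume "\<omega> \<in> space P"
      then have "F (theta n \<omega>) \<le> K" using K[OF theta_space] abs_le_D1 by blast
      then show "h \<omega> * F (theta n \<omega>) \<le> K * h \<omega>" by (simp add: h_def)
    qed
    then show "expectation (\<lambda>\<omega>. h \<omega> * F (theta n \<omega>)) \<le> K * expectation h" by simp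
  qed
  finally have nonneg: "0 \<le> \<delta> * (K * expectation h) + expectation (\<lambda>\<omega>. h \<omega> * G \<omega>)"
    by (simp add: layer)
  let ?g = "\<lambda>\<omega>. h \<omega> * (- K * \<delta> - G \<omega>)"
  have hG: "integrable P (\<lambda>\<omega>. h \<omega> * G \<omega>)"
    by (intro observable_integrable[of "box_V (N + r)"] observable_mult h G)
  have int: "integrable P ?g"
    using hG observable_integrable[OF h] by (simp add: right_diff_distrib)
  have "?g \<omega> \<ge> 0" for \<omega> by (simp add: h_def)
  moreover have "expectation ?g = - (\<delta> * (K * expectation h) + expectation (\<lambda>\<omega>. h \<omega> * G \<omega>))"
    using hG observable_integrable[OF h] by (simp add: right_diff_distrib)
  with nonneg have "expectation ?g \<le> 0" by simp
  ultimately have "expectation ?g = 0"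
    by (intro antisym integral_nonneg_AE) auto
  with int have "AE \<omega> in P. ?g \<omega> = 0"
    by (subst (asm) integral_nonneg_eq_0_iff_AE) (auto simp: h_def)
  then show ?thesis
    by (rule AE_mp) (auto simp: h_def G_def \<delta>_def not_less split: if_splits)
qed

end

section \<open>Exponential rates\<close>

lemma less_ln_ext_iff: "ereal a < ln_ext x \<longleftrightarrow> ennreal (exp a) < x"
proof (cases x)
  case (real r)
  show ?thesis
  proof (cases "r = 0")
    case True
    then show ?thesis using real by (simp add: ln_ext_def)
  next
    case False
    with real have "r > 0" by simp
    then have "a < ln r \<longleftrightarrow> exp a < r" by (metis exp_less_cancel_iff exp_ln)
    then show ?thesis using real \<open>r > 0\<close> by (simp add: ln_ext_def ennreal_less_iff)
  qed
next
  case top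
  then show ?thesis by (simp add: ln_ext_def)
qed

lemma less_ln_ext_rate_iff:
  assumes "N > 0"
  shows "ereal c < ln_ext x / ereal (real N ^ d) \<longleftrightarrow> ennreal (exp (c * real N ^ d)) < x"
proof -
  have "ereal c < ln_ext x / ereal (real N ^ d) \<longleftrightarrow> ereal (real N ^ d) * ereal c < ln_ext x"
    using assms by (intro ereal_less_divide_pos) auto
  then show ?thesis by (simp add: less_ln_ext_iff mult.commute)
qed

text \<open>Positivity of an exponential rate is restated with exponentials, so that the arithmetic below
  takes place between nonnegative quantities and never adds infinite logarithms.\<close>

lemma liminf_rate_pos_iff:
  "liminf (\<lambda>N. ln_ext (y N) / ereal (real N ^ d)) > 0
    \<longleftrightarrow> (\<exists>c>0. eventually (\<lambda>N. ennreal (exp (c * real N ^ d)) < y N) sequentially)"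
proof
  assume "liminf (\<lambda>N. ln_ext (y N) / ereal (real N ^ d)) > 0"
  then obtain c where c: "0 < ereal c" "ereal c < liminf (\<lambda>N. ln_ext (y N) / ereal (real N ^ d))"
    using ereal_dense2 by blast
  have "eventually (\<lambda>N. ereal c < ln_ext (y N) / ereal (real N ^ d)) sequentially"
    using c(2) by (rule less_LiminfD)
  then have "eventually (\<lambda>N. ennreal (exp (c * real N ^ d)) < y N) sequentially"
    using eventually_gt_at_top[of 0] by eventually_elim (simp add: less_ln_ext_rate_iff)
  with c(1) show "\<exists>c>0. eventually (\<lambda>N. ennreal (exp (c * real N ^ d)) < y N) sequentially" by auto
next
  assume "\<exists>c>0. eventually (\<lambda>N. ennreal (exp (c * real N ^ d)) < y N) sequentially"
  then obtain c where "c > 0" and c: "eventually (\<lambda>N. ennreal (exp (c * real N ^ d)) < y N) sequentially"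
    by blast
  have "eventually (\<lambda>N. ereal c \<le> ln_ext (y N) / ereal (real N ^ d)) sequentially"
    using c eventually_gt_at_top[of 0] by eventually_elim (simp add: less_imp_le less_ln_ext_rate_iff)
  then have "ereal c \<le> liminf (\<lambda>N. ln_ext (y N) / ereal (real N ^ d))" by (rule Liminf_bounded)
  then show "liminf (\<lambda>N. ln_ext (y N) / ereal (real N ^ d)) > 0"
    by (rule less_le_trans[rotated]) (simp add: \<open>c > 0\<close>)
qed

lemma measurable_exp_ext [measurable]: "exp_ext \<in> borel_measurable borel"
proof -
  have "exp_ext = (\<lambda>x. if x = \<infinity> then \<infinity> else if x = -\<infinity> then 0 else ennreal (exp (real_of_ereal x)))"
    by (rule ext, rename_tac x, case_tac x) (auto simp: exp_ext_def)
  also have "\<dots> \<in> borel_measurable borel" by measurable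
  finally show ?thesis .
qed

lemma exp_ext_add: "x < \<infinity> \<Longrightarrow> exp_ext (x + ereal g) = exp_ext x * ennreal (exp g)"
  by (cases x) (auto simp: exp_ext_def exp_add ennreal_mult)

section \<open>The interface law\<close>

lemma sets_interface_law: "sets (interface_law U N) = sets config_space"
  by (simp add: interface_law_def ref_measure_def)

text \<open>Finiteness is all that Tonelli's theorem needs: the total mass is \<open>Z / Z\<close>, where the normalising
  integral \<open>Z\<close> is finite.\<close>

lemma finite_measure_interface_law:
  assumes "integrable (ref_measure N :: ('d::finite config) measure) (gibbs_weight U N)"
  shows "finite_measure (interface_law U N :: ('d config) measure)"
proof
  let ?R = "ref_measure N :: ('d config) measure"
  define Z where "Z = (\<integral>\<^sup>+\<phi>. ennreal (gibbs_weight U N \<phi>) \<partial>?R)"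
  have [measurable]: "gibbs_weight U N \<in> borel_measurable ?R" using assms by auto
  have "emeasure (interface_law U N) (space (interface_law U N :: ('d config) measure))
      = (\<integral>\<^sup>+\<phi>. ennreal (gibbs_weight U N \<phi>) / Z \<partial>?R)"
    by (simp add: interface_law_def Z_def emeasure_density cong: nn_integral_cong)
  also have "\<dots> = Z / Z" by (simp add: nn_integral_divide Z_def)
  also have "\<dots> \<noteq> \<infinity>"
  proof -
    have "Z \<noteq> \<infinity>"
      unfolding Z_def using assms by (simp add: integrable_iff_bounded gibbs_weight_def less_top[symmetric])
    then show ?thesis by (cases "Z = 0") (simp_all add: less_top)
  qed
  finally show "emeasure (interface_law U N) (space (interface_law U N :: ('d config) measure)) \<noteq> \<infinity>" .
qed

section \<open>Positivity of the constrained free energy\<close>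

theorem proposition1p5:
  fixes U :: "real \<Rightarrow> real"
    and \<Gamma> :: "real set"
    and P :: "('d::finite config) measure"
    and H :: "nat \<Rightarrow> 'd config \<Rightarrow> 'd config \<Rightarrow> ereal"
    and f :: real
    and F :: "'d config \<Rightarrow> real"
  assumes "CARD('d) > 1"
    and "\<And>r. U (- r) = U r"
    and "U \<in> borel_measurable borel"
    and "filterlim U at_top at_top" and "filterlim U at_top at_bot"
    and "\<And>N. N > 0 \<Longrightarrow> integrable (ref_measure N :: ('d config) measure) (gibbs_weight U N)"
    and "iid_field_law \<Gamma> P"
    and "hamiltonian P H"
    and "basic_hypothesis U P H"
    and "quenched_free_energy U P H f"
    and "annealed_free_energy U P H > 0"
    and "local_function \<Gamma> F"
    and "bounded (F ` space P)"
    and "F \<in> borel_measurable P"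
    and "(\<integral>\<omega>. F \<omega> \<partial>P) = 0"
  shows "liminf (\<lambda>N. ln_ext (\<integral>\<^sup>+(\<omega>, s).
             exp_ext (H N \<omega> s + ereal (\<Sum>n \<in> box_V N. F (theta n \<omega>)))
             \<partial>(P \<Otimes>\<^sub>M interface_law U N)) / ereal (real N ^ CARD('d))) > 0"
proof -
  let ?d = "CARD('d)"
  interpret iid_field \<Gamma> P by unfold_locales (rule assms)
  define \<mu> where "\<mu> N = (interface_law U N :: ('d config) measure)" for N
  define G where "G N \<omega> = (\<Sum>n\<in>box_V N. F (theta n \<omega>))" for N \<omega>
  define y where "y N = (\<integral>\<^sup>+(\<omega>, s). exp_ext (H N \<omega> s + ereal (G N \<omega>)) \<partial>(P \<Otimes>\<^sub>M \<mu> N))" for N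
  obtain K where K: "\<And>\<omega>. \<omega> \<in> space P \<Longrightarrow> \<bar>F \<omega>\<bar> \<le> K"
    using \<open>bounded (F ` space P)\<close> unfolding bounded_iff by auto
  obtain A where "finite A"
    and local: "\<And>\<omega> \<omega>'. \<omega> \<in> space P \<Longrightarrow> \<omega>' \<in> space P \<Longrightarrow> (\<And>n. n \<in> A \<Longrightarrow> \<omega> n = \<omega>' n) \<Longrightarrow> F \<omega> = F \<omega>'"
    using \<open>local_function \<Gamma> F\<close> unfolding local_function_def space_P by metis
  have F: "observable A F" by (rule observableI[OF \<open>F \<in> borel_measurable P\<close> K local])
  obtain r where A: "A \<subseteq> box_V r" using finite_subset_box_V[OF \<open>finite A\<close>] .
  have G_obs: "observable UNIV (G N)" for N
    unfolding G_def[abs_def] by (intro observable_sum observable_mono[OF observable_theta[OF F]]) auto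
  have G_meas [measurable]: "G N \<in> borel_measurable P" for N
    by (rule observable_measurable[OF G_obs])
  have H_less: "H N \<omega> s < \<infinity>" if "N > 0" "\<omega> \<in> space P" for N \<omega> s
    using \<open>hamiltonian P H\<close> that unfolding hamiltonian_def by blast
  \<comment> \<open>The sum of \<open>F\<close> does not involve the interface, so it factors out of the inner integral.\<close>
  have y_eq: "y N = (\<integral>\<^sup>+\<omega>. partition_function U H N \<omega> * ennreal (exp (G N \<omega>)) \<partial>P)"
    and Z_meas: "partition_function U H N \<in> borel_measurable P" if "N > 0" for N
  proof -
    interpret \<mu>: finite_measure "\<mu> N"
      unfolding \<mu>_def by (rule finite_measure_interface_law[OF assms(6)[OF that]])
    have sets_\<mu>: "sets (\<mu> N) = sets config_space" by (simp add: \<mu>_def sets_interface_law)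
    have H_meas [measurable]: "(\<lambda>p. H N (fst p) (snd p)) \<in> borel_measurable (P \<Otimes>\<^sub>M \<mu> N)"
      using \<open>hamiltonian P H\<close> that
      unfolding hamiltonian_def measurable_cong_sets[OF sets_pair_measure_cong[OF refl sets_\<mu>] refl]
      by (simp add: case_prod_unfold)
    have H2 [measurable]: "(\<lambda>s. H N \<omega> s) \<in> borel_measurable (\<mu> N)" if "\<omega> \<in> space P" for \<omega>
      using measurable_compose[OF measurable_Pair1'[OF that] H_meas] by simp
    have "(\<lambda>p. exp_ext (H N (fst p) (snd p))) \<in> borel_measurable (P \<Otimes>\<^sub>M \<mu> N)" by measurable
    from \<mu>.borel_measurable_nn_integral_fst[OF this]
    show "partition_function U H N \<in> borel_measurable P"
      by (simp add: partition_function_def[abs_def] \<mu>_def)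
    have "(\<lambda>p. exp_ext (H N (fst p) (snd p) + ereal (G N (fst p)))) \<in> borel_measurable (P \<Otimes>\<^sub>M \<mu> N)"
      by measurable
    from \<mu>.nn_integral_fst[OF this]
    have "y N = (\<integral>\<^sup>+\<omega>. \<integral>\<^sup>+s. exp_ext (H N \<omega> s + ereal (G N \<omega>)) \<partial>\<mu> N \<partial>P)"
      by (simp add: y_def case_prod_unfold)
    also have "\<dots> = (\<integral>\<^sup>+\<omega>. partition_function U H N \<omega> * ennreal (exp (G N \<omega>)) \<partial>P)"
    proof (rule nn_integral_cong)
      fix \<omega> assume \<omega>: "\<omega> \<in> space P"
      have "(\<integral>\<^sup>+s. exp_ext (H N \<omega> s + ereal (G N \<omega>)) \<partial>\<mu> N) = (\<integral>\<^sup>+s. exp_ext (H N \<omega> s) * ennreal (exp (G N \<omega>)) \<partial>\<mu> N)"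
        by (intro nn_integral_cong exp_ext_add H_less[OF that \<omega>])
      also have "\<dots> = partition_function U H N \<omega> * ennreal (exp (G N \<omega>))"
        using H2[OF \<omega>] by (simp add: nn_integral_multc partition_function_def \<mu>_def)
      finally show "(\<integral>\<^sup>+s. exp_ext (H N \<omega> s + ereal (G N \<omega>)) \<partial>\<mu> N) = partition_function U H N \<omega> * ennreal (exp (G N \<omega>))" .
    qed
    finally show "y N = (\<integral>\<^sup>+\<omega>. partition_function U H N \<omega> * ennreal (exp (G N \<omega>)) \<partial>P)" .
  qed
  have "\<exists>c>0. eventually (\<lambda>N. ennreal (exp (c * real N ^ ?d)) < y N) sequentially"
  proof (cases "\<forall>b h. observable (box_V b) h \<longrightarrow> (\<Sum>m\<in>box_V (b + r). expectation (\<lambda>\<omega>. h \<omega> * F (theta m \<omega>))) = 0")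
    case True
    \<comment> \<open>The sum of \<open>F\<close> is bounded below by a boundary term, and the annealed free energy decides.\<close>
    define \<delta> where "\<delta> N = K * (real (card (box_V (N + 2 * r) :: (int ^ 'd) set)) - real (card (box_V N :: (int ^ 'd) set)))" for N
    have G_ge: "AE \<omega> in P. - \<delta> N \<le> G N \<omega>" for N
      using boundary_lower_bound[OF F A K, of N] True by (simp add: \<delta>_def G_def)
    have lower: "(\<integral>\<^sup>+\<omega>. partition_function U H N \<omega> \<partial>P) * ennreal (exp (- \<delta> N)) \<le> y N" if "N > 0" for N
      unfolding y_eq[OF that] nn_integral_multc[OF Z_meas[OF that], symmetric]
    proof (rule nn_integral_mono_AE)
      show "AE \<omega> in P. partition_function U H N \<omega> * ennreal (exp (- \<delta> N))
          \<le> partition_function U H N \<omega> * ennreal (exp (G N \<omega>))"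
        using G_ge[of N] by eventually_elim (intro mult_left_mono ennreal_leI, simp_all)
    qed
    obtain c where "c > 0"
      and Z: "eventually (\<lambda>N. ennreal (exp (c * real N ^ ?d)) < (\<integral>\<^sup>+\<omega>. partition_function U H N \<omega> \<partial>P)) sequentially"
      using \<open>annealed_free_energy U P H > 0\<close> unfolding annealed_free_energy_def liminf_rate_pos_iff by (elim exE conjE)
    have "eventually (\<lambda>N. \<delta> N \<le> c / 2 * real N ^ ?d) sequentially"
      unfolding \<delta>_def using \<open>c > 0\<close> by (intro eventually_box_layer_le) simp
    then have "eventually (\<lambda>N. ennreal (exp (c / 2 * real N ^ ?d)) < y N) sequentially"
      using Z eventually_gt_at_top[of 0]
    proof eventually_elim
      case (elim N)
      have "ennreal (exp (c / 2 * real N ^ ?d)) \<le> ennreal (exp (c * real N ^ ?d) * exp (- \<delta> N))"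
        using elim(1) by (intro ennreal_leI) (simp add: exp_add[symmetric])
      also have "\<dots> = ennreal (exp (c * real N ^ ?d)) * ennreal (exp (- \<delta> N))"
        by (simp add: ennreal_mult)
      also have "\<dots> < (\<integral>\<^sup>+\<omega>. partition_function U H N \<omega> \<partial>P) * ennreal (exp (- \<delta> N))"
        using elim(2) by (intro ennreal_mult_strict_right_mono) auto
      also have "\<dots> \<le> y N" by (rule lower[OF elim(3)])
      finally show ?case .
    qed
    with \<open>c > 0\<close> show ?thesis by (intro exI[of _ "c / 2"]) simp
  next
    case False
    \<comment> \<open>The exponential moment of the sum of \<open>F\<close> alone grows; the event \<open>S \<in> D\<close> costs less.\<close>
    then obtain b h where h: "observable (box_V b) h"
      and corr: "(\<Sum>m\<in>box_V (b + r). expectation (\<lambda>\<omega>. h \<omega> * F (theta m \<omega>))) \<noteq> 0"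
      by blast
    obtain c where "c > 0"
      and growth: "eventually (\<lambda>N. exp (c * real N ^ ?d) \<le> expectation (\<lambda>\<omega>. exp (G N \<omega>))) sequentially"
      using exponential_growth[OF F \<open>(\<integral>\<omega>. F \<omega> \<partial>P) = 0\<close> A h corr] unfolding G_def by (elim exE conjE)
    obtain D :: "int ^ 'd \<Rightarrow> real set" where D_meas: "\<forall>n. D n \<in> sets borel"
      and D_lim: "(\<lambda>N. ln_ext (emeasure (\<mu> N) {s \<in> space (\<mu> N). \<forall>n \<in> box_V N. s n \<in> D n})
          / ereal (real N ^ ?d)) \<longlonglongrightarrow> 0"
      and D_zero: "\<forall>N>0. \<forall>\<omega> \<in> space P. \<forall>s. (\<forall>n \<in> box_V N. s n \<in> D n) \<longrightarrow> H N \<omega> s = 0"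
      using \<open>basic_hypothesis U P H\<close> unfolding basic_hypothesis_def \<mu>_def by (elim exE conjE)
    define E where "E N = {s \<in> space (\<mu> N). \<forall>n \<in> box_V N. s n \<in> D n}" for N
    have E_meas: "E N \<in> sets (\<mu> N)" for N
    proof -
      have [measurable]: "(\<lambda>s. s n) \<in> borel_measurable (\<mu> N)" for n
        unfolding \<mu>_def measurable_cong_sets[OF sets_interface_law refl] config_space_def
        by (rule measurable_component_singleton) simp
      note D_meas [rule_format, measurable]
      show ?thesis unfolding E_def by (rule sets.sets_Collect_finite_All[OF _ finite_box_V]) measurable
    qed
    have Z_ge: "emeasure (\<mu> N) (E N) \<le> partition_function U H N \<omega>" if "N > 0" "\<omega> \<in> space P" for N \<omega>
    proof -
      have "emeasure (\<mu> N) (E N) = (\<integral>\<^sup>+s. indicator (E N) s \<partial>\<mu> N)" by (simp add: E_meas)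
      also have "\<dots> \<le> (\<integral>\<^sup>+s. exp_ext (H N \<omega> s) \<partial>\<mu> N)"
        by (intro nn_integral_mono)
          (use D_zero that in \<open>auto simp: indicator_def E_def exp_ext_def zero_ereal_def\<close>)
      finally show ?thesis by (simp add: partition_function_def \<mu>_def)
    qed
    have lower: "emeasure (\<mu> N) (E N) * ennreal (expectation (\<lambda>\<omega>. exp (G N \<omega>))) \<le> y N" if "N > 0" for N
    proof -
      obtain L where "L \<ge> 0" and L: "\<And>\<omega>. \<omega> \<in> space P \<Longrightarrow> \<bar>G N \<omega>\<bar> \<le> L"
        by (rule observable_bound[OF G_obs[of N]]) blast
      have "integrable P (\<lambda>\<omega>. exp (G N \<omega>))"
        by (rule integrable_const_bound[of _ "exp L"]) (use L in \<open>auto simp: abs_le_iff\<close>)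
      then have "emeasure (\<mu> N) (E N) * ennreal (expectation (\<lambda>\<omega>. exp (G N \<omega>)))
          = (\<integral>\<^sup>+\<omega>. emeasure (\<mu> N) (E N) * ennreal (exp (G N \<omega>)) \<partial>P)"
        by (simp add: nn_integral_cmult nn_integral_eq_integral)
      also have "\<dots> \<le> y N"
        unfolding y_eq[OF that] by (intro nn_integral_mono mult_right_mono Z_ge that) auto
      finally show ?thesis .
    qed
    have "eventually (\<lambda>N. ereal (- c / 2) < ln_ext (emeasure (\<mu> N) (E N)) / ereal (real N ^ ?d)) sequentially"
      using D_lim unfolding E_def by (rule order_tendstoD) (use \<open>c > 0\<close> in simp)
    then have "eventually (\<lambda>N. ennreal (exp (c / 2 * real N ^ ?d)) < y N) sequentially"
      using growth eventually_gt_at_top[of 0]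
    proof eventually_elim
      case (elim N)
      then have D_rate: "ennreal (exp (- c / 2 * real N ^ ?d)) < emeasure (\<mu> N) (E N)"
        by (simp only: less_ln_ext_rate_iff)
      have "ennreal (exp (c / 2 * real N ^ ?d)) = ennreal (exp (- c / 2 * real N ^ ?d) * exp (c * real N ^ ?d))"
        by (simp add: exp_add[symmetric])
      also have "\<dots> = ennreal (exp (- c / 2 * real N ^ ?d)) * ennreal (exp (c * real N ^ ?d))"
        by (simp add: ennreal_mult)
      also have "\<dots> < emeasure (\<mu> N) (E N) * ennreal (exp (c * real N ^ ?d))"
        using D_rate by (intro ennreal_mult_strict_right_mono) auto
      also have "\<dots> \<le> emeasure (\<mu> N) (E N) * ennreal (expectation (\<lambda>\<omega>. exp (G N \<omega>)))"
        using elim(2) by (intro mult_left_mono ennreal_leI) auto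
      also have "\<dots> \<le> y N" by (rule lower[OF elim(3)])
      finally show ?case .
    qed
    with \<open>c > 0\<close> show ?thesis by (intro exI[of _ "c / 2"]) simp
  qed
  then show ?thesis
    unfolding y_def \<mu>_def G_def liminf_rate_pos_iff .
qed

end
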